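(* Let $\mathbb{F}$ be a finite field with $q=|\mathbb{F}|$ elements, let $V$ be a finite-dimensional $\mathbb{F}$-vector space, let $r$ be a positive integer and let $\underline{s}=(s_1>s_2>\cdots>s_r>s_{r+1}=0)$ be a strictly decreasing sequence of integers such that $[s_i-s_{i+1}]_q\ \geq\ (q-1)(\dim V-i+1)$ for all $1\leq i\leq r$. Then the morphism $\phi_{\underline{s}}$ induces a monomorphism $$\phi_{\underline{s}}(V):\ \mathbb{F}[\mathfrak{Flag}_r](V)\hookrightarrow \Gamma^{[\underline{s}]_q}(V).$$
   Context: Notation. For a natural number $s$, $[s]_q:=q^s-1$; for a sequence $\underline{s}=(s_1\geq\cdots\geq s_r>s_{r+1}=0)$ of integers, $[\underline{s}]_q:=\sum_{i=1}^r [s_i]_q$. Divided powers. $\Gamma^n(V):=(V^{\otimes n})^{\mathfrak{S}_n}$ is the $n$th divided power functor (symmetric tensors), $\Gamma^0=\mathbb{F}$. $\Gamma^*(V)=\bigoplus_n\Gamma^n(V)$ is a graded commutative associative algebra under the divided power (shuffle) product $\Gamma^a\otimes\Gamma^b\to\Gamma^{a+b}$. For $x\in V$, $x^{\otimes n}\in\Gamma^n(V)$ denotes the corresponding symmetric tensor, so that $x^{\otimes a}x^{\otimes b}=\binom{a+b}{a}x^{\otimes(a+b)}$. Flags. A complete flag of length $r$ in $V$ is a chain of subspaces $W_1<W_2<\cdots<W_r\leq V$ with $\dim W_i=i$. $\mathbb{F}[\mathfrak{Flag}_r](V)$ is the $\mathbb{F}$-vector space with basis the set of complete flags of length $r$ in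 $V$; it is a functor of $V$, a linear map sending a complete flag to its image if this is a complete flag, and to zero otherwise. The morphism $\phi_{\underline{s}}$. $\phi_{\underline{s}}:\mathbb{F}[\mathfrak{Flag}_r]\to\Gamma^{[\underline{s}]_q}$ is the natural transformation sending the complete flag $\langle v_1\rangle<\langle v_1,v_2\rangle<\cdots<\langle v_1,\dots,v_r\rangle$ (with $v_1,\dots,v_r\in V$ linearly independent) to the product $\prod_{i=1}^r v_i^{\otimes[s_i]_q}\in\Gamma^{[\underline{s}]_q}(V)$; this is well defined, independent of the choice of the $v_i$. *)

theory Defs
  imports
    "HOL.Vector_Spaces"
    "HOL-Library.Cardinality"
    "HOL-Library.Poly_Mapping"
    "HOL-Combinatorics.Permutations"
begin

section \<open>Free vector spaces\<close>

text \<open>The free vector space on a set of generators of type \<open>'k\<close> is \<open>'k \<Rightarrow>\<^sub>0 'a\<close>; a generator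
  \<open>k\<close> is \<open>Poly_Mapping.single k 1\<close>.\<close>

definition free_scale :: "'a::field \<Rightarrow> ('k \<Rightarrow>\<^sub>0 'a) \<Rightarrow> ('k \<Rightarrow>\<^sub>0 'a)" where
  "free_scale c = Poly_Mapping.map ((*) c)"

lemma lookup_free_scale [simp]:
  "Poly_Mapping.lookup (free_scale c p) k = c * Poly_Mapping.lookup p k"
  by (simp add: free_scale_def Poly_Mapping.map.rep_eq when_def)

global_interpretation free: vector_space "free_scale :: 'a::field \<Rightarrow> ('k \<Rightarrow>\<^sub>0 'a) \<Rightarrow> ('k \<Rightarrow>\<^sub>0 'a)"
  by unfold_locales (auto intro!: poly_mapping_eqI simp: lookup_add algebra_simps)

definition free_on :: "'k set \<Rightarrow> ('k \<Rightarrow>\<^sub>0 'a::field) set" where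
  "free_on K = {p. Poly_Mapping.keys p \<subseteq> K}"

definition free_lift :: "('k \<Rightarrow> ('l \<Rightarrow>\<^sub>0 'a::field)) \<Rightarrow> ('k \<Rightarrow>\<^sub>0 'a) \<Rightarrow> ('l \<Rightarrow>\<^sub>0 'a)" where
  "free_lift h p = (\<Sum>k\<in>Poly_Mapping.keys p. free_scale (Poly_Mapping.lookup p k) (h k))"

text \<open>All shuffles of two words. Unlike the set \<open>shuffles\<close>, this lists a word once for every way it
  arises, as the divided power identity \<open>free_shuffle_replicate\<close> below requires.\<close>

fun riffles :: "'b list \<Rightarrow> 'b list \<Rightarrow> 'b list list" where
  "riffles [] ys = [ys]"
| "riffles (x # xs) [] = [x # xs]"
| "riffles (x # xs) (y # ys) =
     map ((#) x) (riffles xs (y # ys)) @ map ((#) y) (riffles (x # xs) ys)"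

definition free_shuffle :: "('b list \<Rightarrow>\<^sub>0 'a::field) \<Rightarrow> ('b list \<Rightarrow>\<^sub>0 'a) \<Rightarrow> ('b list \<Rightarrow>\<^sub>0 'a)" where
  "free_shuffle p q =
     free_lift (\<lambda>xs. free_lift (\<lambda>ys. \<Sum>zs\<leftarrow>riffles xs ys. Poly_Mapping.single zs 1) q) p"

definition free_permute :: "(nat \<Rightarrow> nat) \<Rightarrow> ('b list \<Rightarrow>\<^sub>0 'a::field) \<Rightarrow> ('b list \<Rightarrow>\<^sub>0 'a)" where
  "free_permute \<sigma> = free_lift (\<lambda>xs. Poly_Mapping.single (permute_list \<sigma> xs) 1)"

lemma free_lift_single: "free_lift h (Poly_Mapping.single k c) = free_scale c (h k)"
  by (cases "c = 0") (simp_all add: free_lift_def)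

lemma set_riffles: "set (riffles xs ys) = shuffles xs ys"
  by (induction xs ys rule: riffles.induct) auto

lemma length_riffles: "length (riffles xs ys) = (length xs + length ys) choose (length xs)"
proof (induction xs ys rule: riffles.induct)
  case (3 x xs y ys)
  then show ?case
    using binomial_Suc_Suc[of "length xs + Suc (length ys)" "length xs"] by simp
qed auto

lemma free_shuffle_replicate:
  "free_shuffle (Poly_Mapping.single (replicate a x) 1) (Poly_Mapping.single (replicate b x) 1) =
     free_scale (of_nat ((a + b) choose a)) (Poly_Mapping.single (replicate (a + b) x) (1 :: 'a::field))"
proof -
  have *: "zs = replicate (a + b) x" if "zs \<in> set (riffles (replicate a x) (replicate b x))" for zs
  proof -
    have "length zs = a + b" "set zs \<subseteq> {x}"
      using that length_shuffles[of zs "replicate a x" "replicate b x"]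
            set_shuffles[of zs "replicate a x" "replicate b x"]
      by (auto simp: set_riffles)
    then show ?thesis by (intro replicate_eqI) auto
  qed
  have "riffles (replicate a x) (replicate b x) =
             replicate ((a + b) choose a) (replicate (a + b) x)"
    by (rule replicate_eqI) (use * in \<open>auto simp: length_riffles\<close>)
  moreover have "(\<Sum>zs\<leftarrow>replicate m w. Poly_Mapping.single zs (1 :: 'a)) =
      free_scale (of_nat m) (Poly_Mapping.single w 1)" for m and w :: "'b list"
    by (induction m) (auto intro!: poly_mapping_eqI simp: lookup_add lookup_single when_def algebra_simps)
  ultimately show ?thesis by (simp add: free_shuffle_def free_lift_single)
qed

text \<open>\<open>[k]\<^sub>q = q ^ k - 1\<close>; the subtraction never truncates for \<open>q \<ge> 1\<close>.\<close>

definition q_bracket :: "nat \<Rightarrow> nat \<Rightarrow> nat" where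
  "q_bracket q k = q ^ k - 1"

text \<open>\<open>[[s 1]\<^sub>q, \<dots>, [s r]\<^sub>q]\<close>; other values of \<open>s\<close> are ignored.\<close>

definition q_brackets :: "nat \<Rightarrow> nat \<Rightarrow> (nat \<Rightarrow> nat) \<Rightarrow> nat list" where
  "q_brackets q r s = map (\<lambda>i. q_bracket q (s i)) [1..<Suc r]"

section \<open>Tensor powers and divided powers\<close>

context vector_space
begin

text \<open>The tensor power \<open>V\<^sup>\<otimes>\<^sup>n\<close> is the quotient of the free vector space on \<open>V\<^sup>n\<close> (words of length
  \<open>n\<close>) by the multilinearity relations. Its elements are equivalence classes.\<close>

definition words :: "nat \<Rightarrow> ('b list \<Rightarrow>\<^sub>0 'a) set" where
  "words n = free_on {xs. length xs = n}"

definition tensor_relations :: "nat \<Rightarrow> ('b list \<Rightarrow>\<^sub>0 'a) set" where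
  "tensor_relations n = free.span
     ({Poly_Mapping.single (xs @ (x + y) # ys) 1 - Poly_Mapping.single (xs @ x # ys) 1
         - Poly_Mapping.single (xs @ y # ys) 1 | xs x y ys. length xs + Suc (length ys) = n} \<union>
      {Poly_Mapping.single (xs @ (c *s x) # ys) 1 - free_scale c (Poly_Mapping.single (xs @ x # ys) 1)
         | xs c x ys. length xs + Suc (length ys) = n})"

definition tensor_eq :: "nat \<Rightarrow> (('b list \<Rightarrow>\<^sub>0 'a) \<times> ('b list \<Rightarrow>\<^sub>0 'a)) set" where
  "tensor_eq n = {(p, p'). p \<in> words n \<and> p' \<in> words n \<and> p - p' \<in> tensor_relations n}"

lemma equiv_tensor_eq: "equiv (words n) (tensor_eq n)"
proof (intro equivI)
  have S: "free.subspace (tensor_relations n)"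
    by (simp add: tensor_relations_def)
  show "sym (tensor_eq n)"
    using free.subspace_neg[OF S] by (fastforce simp: sym_def tensor_eq_def)
  show "trans (tensor_eq n)"
    using free.subspace_add[OF S] by (fastforce simp: trans_def tensor_eq_def)
qed (auto simp: tensor_eq_def refl_on_def tensor_relations_def free.span_zero)

definition tensor_power :: "nat \<Rightarrow> ('b list \<Rightarrow>\<^sub>0 'a) set set" where
  "tensor_power n = words n // tensor_eq n"

definition tensor_add ::
    "nat \<Rightarrow> ('b list \<Rightarrow>\<^sub>0 'a) set \<Rightarrow> ('b list \<Rightarrow>\<^sub>0 'a) set \<Rightarrow> ('b list \<Rightarrow>\<^sub>0 'a) set" where
  "tensor_add n A B = (\<Union>a\<in>A. \<Union>b\<in>B. tensor_eq n `` {a + b})"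

definition tensor_scale ::
    "nat \<Rightarrow> 'a \<Rightarrow> ('b list \<Rightarrow>\<^sub>0 'a) set \<Rightarrow> ('b list \<Rightarrow>\<^sub>0 'a) set" where
  "tensor_scale n c A = (\<Union>a\<in>A. tensor_eq n `` {free_scale c a})"

text \<open>\<open>tensor_lift n h\<close> is the linear extension of a map \<open>h\<close> from generators to the \<open>n\<close>-th tensor
  power: choose representatives \<open>\<rho> k \<in> h k\<close> and take the class of the linear combination.\<close>

definition tensor_lift ::
    "nat \<Rightarrow> ('k \<Rightarrow> ('b list \<Rightarrow>\<^sub>0 'a) set) \<Rightarrow> ('k \<Rightarrow>\<^sub>0 'a) \<Rightarrow> ('b list \<Rightarrow>\<^sub>0 'a) set" where
  "tensor_lift n h x = (\<Union>\<rho>\<in>Pi (Poly_Mapping.keys x) h. tensor_eq n `` {free_lift \<rho> x})"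

definition tensor_permute ::
    "nat \<Rightarrow> (nat \<Rightarrow> nat) \<Rightarrow> ('b list \<Rightarrow>\<^sub>0 'a) set \<Rightarrow> ('b list \<Rightarrow>\<^sub>0 'a) set" where
  "tensor_permute n \<sigma> A = (\<Union>a\<in>A. tensor_eq n `` {free_permute \<sigma> a})"

definition divided_power :: "nat \<Rightarrow> ('b list \<Rightarrow>\<^sub>0 'a) set set" where
  "divided_power n = {A \<in> tensor_power n. \<forall>\<sigma>. \<sigma> permutes {..<n} \<longrightarrow> tensor_permute n \<sigma> A = A}"

definition shuffle_product ::
    "nat \<Rightarrow> nat \<Rightarrow> ('b list \<Rightarrow>\<^sub>0 'a) set \<Rightarrow> ('b list \<Rightarrow>\<^sub>0 'a) set \<Rightarrow> ('b list \<Rightarrow>\<^sub>0 'a) set" where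
  "shuffle_product m n A B = (\<Union>a\<in>A. \<Union>b\<in>B. tensor_eq (m + n) `` {free_shuffle a b})"

definition pure_power :: "nat \<Rightarrow> 'b \<Rightarrow> ('b list \<Rightarrow>\<^sub>0 'a) set" where
  "pure_power n x = tensor_eq n `` {Poly_Mapping.single (replicate n x) 1}"

text \<open>\<open>pure_power_product [n\<^sub>1, \<dots>, n\<^sub>r] [v\<^sub>1, \<dots>, v\<^sub>r]\<close> is the shuffle product of the tensors
  \<open>v\<^sub>i\<^sup>\<otimes>\<^sup>n\<^sup>i\<close>. The empty product is the unit of \<open>\<Gamma>\<^sup>0\<close>.\<close>

fun pure_power_product :: "nat list \<Rightarrow> 'b list \<Rightarrow> ('b list \<Rightarrow>\<^sub>0 'a) set" where
  "pure_power_product (n # ns) (v # vs) =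
     shuffle_product n (sum_list ns) (pure_power n v) (pure_power_product ns vs)"
| "pure_power_product _ _ = tensor_eq 0 `` {Poly_Mapping.single [] 1}"

section \<open>Flags and the morphism\<close>

text \<open>A complete flag \<open>W\<^sub>1 < \<dots> < W\<^sub>r\<close> is the list \<open>[W\<^sub>1, \<dots>, W\<^sub>r]\<close>.\<close>

definition complete_flags :: "nat \<Rightarrow> 'b set list set" where
  "complete_flags r = {W. length W = r \<and> (\<forall>i<r. subspace (W ! i) \<and> dim (W ! i) = Suc i)
                          \<and> (\<forall>i. Suc i < r \<longrightarrow> W ! i \<subset> W ! Suc i)}"

definition flag_space :: "nat \<Rightarrow> ('b set list \<Rightarrow>\<^sub>0 'a) set" where
  "flag_space r = free_on (complete_flags r)"

definition frames :: "nat \<Rightarrow> 'b list set" where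
  "frames r = {vs. length vs = r \<and> distinct vs \<and> independent (set vs)}"

definition flag_of :: "'b list \<Rightarrow> 'b set list" where
  "flag_of vs = map (\<lambda>i. span (set (take (Suc i) vs))) [0..<length vs]"

text \<open>The product is independent of the frame \<open>vs\<close> of the flag when \<open>s\<close> is strictly decreasing, so
  \<open>THE\<close> picks out the common value.\<close>

definition flag_value :: "nat \<Rightarrow> (nat \<Rightarrow> nat) \<Rightarrow> 'b set list \<Rightarrow> ('b list \<Rightarrow>\<^sub>0 'a) set" where
  "flag_value r s W =
     (THE t. \<exists>vs\<in>frames r. flag_of vs = W \<and> t = pure_power_product (q_brackets CARD('a) r s) vs)"

definition phi :: "nat \<Rightarrow> (nat \<Rightarrow> nat) \<Rightarrow> ('b set list \<Rightarrow>\<^sub>0 'a) \<Rightarrow> ('b list \<Rightarrow>\<^sub>0 'a) set" where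
  "phi r s = tensor_lift (sum_list (q_brackets CARD('a) r s)) (flag_value r s)"

end

end

theory Submission
  imports Defs "HOL-Computational_Algebra.Polynomial" "HOL-Library.Multiset"
begin

text \<open>
  A tensor is determined by its values under the multilinear forms \<open>l\<^sub>1 \<otimes> \<dots> \<otimes> l\<^sub>N\<close>, and the value at a
  divided power product of the \<open>v\<^sub>j\<close> with exponents \<open>n\<^sub>j\<close> is the coefficient of the monomial \<open>\<Prod>t\<^sub>j\<^bsup>n\<^sub>j\<^esup>\<close>
  in \<open>\<Prod>\<^sub>k l\<^sub>k(\<Sum>\<^sub>j t\<^sub>j v\<^sub>j)\<close>. For \<open>n\<^sub>j = q\<^bsup>s\<^sub>j\<^esup> - 1\<close> a substitution \<open>v\<^sub>i \<mapsto> c v\<^sub>i + d v\<^sub>j\<close> with \<open>j < i\<close>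
  does not change this coefficient, because of carries in binomial coefficients; so the product depends
  on the flag only.

  For injectivity, let \<open>x\<^sub>1, \<dots>, x\<^sub>d\<close> be dual to a basis adapted to a given flag, put
  \<open>m\<^sub>i = q\<^bsup>s\<^sub>i - s\<^sub>i\<^sub>+\<^sub>1\<^esup> - 1\<close>, and let \<open>f\<^sub>i\<close> be the product of \<open>(x\<^sub>1 \<cdots> x\<^sub>i\<^sub>-\<^sub>1)\<^bsup>m\<^sub>i\<^esup>\<close>, of a power of \<open>x\<^sub>i\<close> and of all
  \<open>x\<^sub>i - c x\<^sub>a\<close> with \<open>a > i\<close> and \<open>c \<noteq> 0\<close>, of total degree \<open>i m\<^sub>i\<close>. The hypothesis on \<open>s\<close> says that
  the power of \<open>x\<^sub>i\<close> has positive exponent. Since \<open>\<Prod>\<^sub>i f\<^sub>i\<^bsup>q^s\<^sub>i\<^sub>+\<^sub>1\<^esup>\<close> involves Frobenius twists, its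
  relevant coefficient is the product over \<open>i\<close> of the coefficients of \<open>\<Prod>\<^sub>j\<^sub>\<le>\<^sub>i t\<^sub>j\<^bsup>m\<^sub>i\<^esup>\<close> in
  \<open>f\<^sub>i(\<Sum>\<^sub>j t\<^sub>j v\<^sub>j)\<close>. All of these are \<open>1\<close> on the given flag, and on any other flag the one at the first
  index where the flags differ vanishes.
\<close>

section \<open>Finite fields\<close>

text \<open>Multiplication by a nonzero x permutes the nonzero elements; cancelling their product
  gives x^(q-1) = 1.\<close>

lemma power_card_power_eq:
  fixes x :: "'a::{field,finite}"
  shows "x ^ (CARD('a) ^ e) = x"
proof -
  have *: "x ^ CARD('a) = x"
  proof (cases "x = 0")
    case False
    let ?P = "\<Prod>(UNIV - {0 :: 'a})"
    have "bij_betw ((*) x) (UNIV - {0}) (UNIV - {0})"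
      by (rule bij_betw_byWitness[where f' = "\<lambda>y. y / x"]) (use False in auto)
    then have "x ^ (CARD('a) - 1) * ?P = 1 * ?P"
      using prod.reindex_bij_betw[of "(*) x" "UNIV - {0}" "UNIV - {0}" "\<lambda>y. y"]
      by (simp add: prod.distrib card_Diff_singleton)
    then have "x ^ (CARD('a) - 1) = 1"
      by (subst (asm) mult_right_cancel) auto
    moreover have "x ^ CARD('a) = x * x ^ (CARD('a) - 1)"
      by (subst power_Suc [symmetric]) auto
    ultimately show ?thesis by simp
  qed (simp add: zero_power)
  show ?thesis
    by (induction e) (simp_all add: * power_mult)
qed

lemma power_card_power_minus_one:
  fixes c :: "'a::{field,finite}"
  assumes "c \<noteq> 0"
  shows "c ^ (CARD('a) ^ e - 1) = 1"
proof -
  have "c * c ^ (CARD('a) ^ e - 1) = c ^ (CARD('a) ^ e)"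
    by (subst power_Suc [symmetric]) auto
  then show ?thesis
    using assms by (simp add: power_card_power_eq)
qed

lemma coeff_one_plus_X_power:
  "coeff ([:1, 1:] ^ n :: 'a::comm_semiring_1 poly) k = of_nat (n choose k)"
proof (cases "k \<le> n")
  case False
  then have "degree ([:1, 1:] ^ n :: 'a poly) < k"
    using degree_power_le[of "[:1, 1:] :: 'a poly" n] by (simp add: pCons_one split: if_splits)
  then show ?thesis
    using False by (simp add: coeff_eq_0 binomial_eq_0)
qed (simp add: coeff_linear_poly_power)

text \<open>The polynomial (1+X)^q - X^q - 1 has degree below q but vanishes at all q elements of
  the field, so it is zero. This treats q directly, without passing through the
  characteristic.\<close>

lemma of_nat_card_choose_eq_0:
  assumes "0 < k" "k < CARD('a::{field,finite})"
  shows "of_nat (CARD('a) choose k) = (0 :: 'a)"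
proof -
  let ?q = "CARD('a)"
  define P :: "'a poly" where "P = [:1, 1:] ^ ?q - monom 1 ?q - 1"
  have coeffs: "coeff P j = of_nat (?q choose j) - (if j = ?q then 1 else 0) - (if j = 0 then 1 else 0)" for j
    by (simp add: P_def coeff_one_plus_X_power coeff_1)
  have "P = 0"
  proof (rule ccontr)
    assume "P \<noteq> 0"
    have "poly P x = 0" for x
      using power_card_power_eq[of x 1] power_card_power_eq[of "1 + x" 1] 
      by (simp add: P_def poly_monom)
    then have "?q \<le> degree P"
      using card_poly_roots_bound[OF \<open>P \<noteq> 0\<close>] by simp
    moreover have "degree P < ?q"
      using \<open>P \<noteq> 0\<close> by (intro degree_lessI) (auto simp: coeffs binomial_eq_0)
    ultimately show False by simp
  qed
  then show ?thesis
    using coeffs[of k] assms by simp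
qed

text \<open>The generality of semirings serves two applications: to univariate polynomials and to
  the monoid algebra of multisets.\<close>

lemma add_power_power_of_choose_eq_0:
  fixes x y :: "'r::comm_semiring_1"
  assumes "\<And>k. 0 < k \<Longrightarrow> k < q \<Longrightarrow> of_nat (q choose k) = (0 :: 'r)" and "q > 0"
  shows "(x + y) ^ (q ^ e) = x ^ (q ^ e) + y ^ (q ^ e)"
proof (induction e)
  case (Suc e)
  have *: "(x + y) ^ q = x ^ q + y ^ q" for x y :: 'r
  proof -
    have "(x + y) ^ q = (\<Sum>k\<le>q. of_nat (q choose k) * x ^ k * y ^ (q - k))"
      by (rule binomial_ring)
    also have "\<dots> = (\<Sum>k\<in>{0, q}. of_nat (q choose k) * x ^ k * y ^ (q - k))"
      by (intro sum.mono_neutral_right) (use assms in auto)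
    finally show ?thesis
      using \<open>q > 0\<close> by (simp add: add_ac)
  qed
  have "(x + y) ^ (q ^ Suc e) = ((x + y) ^ (q ^ e)) ^ q"
    by (simp add: mult.commute flip: power_mult)
  also have "\<dots> = x ^ (q ^ Suc e) + y ^ (q ^ Suc e)"
    by (simp add: Suc * mult.commute flip: power_mult)
  finally show ?case .
qed simp

text \<open>Compare coefficients in (1+X)^(q^e) = 1 + X^(q^e).\<close>

lemma of_nat_card_power_choose_eq_0:
  assumes "0 < k" "k < CARD('a::{field,finite}) ^ e"
  shows "of_nat (CARD('a) ^ e choose k) = (0 :: 'a)"
proof -
  have "of_nat (CARD('a) choose j) = (0 :: 'a poly)" if "0 < j" "j < CARD('a)" for j
    using of_nat_card_choose_eq_0[OF that] by (simp add: of_nat_poly)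
  from add_power_power_of_choose_eq_0[OF this, of 1 "monom 1 1" e]
  have "(1 + monom 1 1) ^ (CARD('a) ^ e) = (1 + monom 1 (CARD('a) ^ e) :: 'a poly)"
    by (simp add: monom_power)
  moreover have "1 + monom 1 1 = ([:1, 1:] :: 'a poly)"
    by (simp add: monom_altdef one_pCons)
  ultimately have "[:1, 1:] ^ (CARD('a) ^ e) = (1 + monom 1 (CARD('a) ^ e) :: 'a poly)"
    by simp
  from arg_cong[OF this, of "\<lambda>p. coeff p k"] show ?thesis
    using assms by (simp add: coeff_one_plus_X_power coeff_1)
qed

text \<open>The addition of \<open>b\<close> to \<open>q ^ e - 1\<close> produces a carry; in terms of Vandermonde's convolution
  with \<open>q ^ e + (b - 1)\<close>, every summand vanishes.\<close>

lemma of_nat_choose_carry_eq_0: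
  assumes "0 < b" "b < CARD('a::{field,finite}) ^ e"
  shows "of_nat (CARD('a) ^ e - 1 + b choose b) = (0 :: 'a)"
proof -
  let ?Q = "CARD('a) ^ e"
  have "of_nat ((?Q + (b - 1)) choose b) = (\<Sum>k\<le>b. of_nat (?Q choose k) * of_nat ((b - 1) choose (b - k)) :: 'a)"
    by (simp add: vandermonde flip: of_nat_mult of_nat_sum)
  also have "\<dots> = 0"
  proof (intro sum.neutral ballI)
    fix k assume "k \<in> {..b}"
    \<comment> \<open>For k = 0 the second factor is (b-1 choose b) = 0; for 0 < k <= b < q^e the
      first factor vanishes.\<close>
    then show "of_nat (?Q choose k) * of_nat ((b - 1) choose (b - k)) = (0 :: 'a)"
      using assms of_nat_card_power_choose_eq_0[where 'a = 'a, of k e]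
      by (cases "k = 0") (auto simp: binomial_eq_0)
  qed
  finally show ?thesis using assms by simp
qed

section \<open>Polynomials with multisets as exponents\<close>

abbreviation (input) lookup :: "('k \<Rightarrow>\<^sub>0 'a::zero) \<Rightarrow> 'k \<Rightarrow> 'a" where
  "lookup \<equiv> Poly_Mapping.lookup"

abbreviation (input) keys :: "('k \<Rightarrow>\<^sub>0 'a::zero) \<Rightarrow> 'k set" where
  "keys \<equiv> Poly_Mapping.keys"

abbreviation (input) single :: "'k \<Rightarrow> 'a \<Rightarrow> ('k \<Rightarrow>\<^sub>0 'a::zero)" where
  "single \<equiv> Poly_Mapping.single"

lemma lookup_sum_list: "lookup (sum_list ps) k = (\<Sum>p\<leftarrow>ps. lookup p k)"
  by (induction ps) (simp_all add: lookup_add)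

lemma sum_single_lookup: "(\<Sum>k\<in>keys p. single k (lookup p k)) = p"
proof (rule poly_mapping_eqI)
  fix j
  have "(\<Sum>k\<in>keys p. lookup (single k (lookup p k)) j) = (\<Sum>k\<in>keys p. if k = j then lookup p k else 0)"
    by (intro sum.cong) (auto simp: lookup_single when_def)
  then show "lookup (\<Sum>k\<in>keys p. single k (lookup p k)) j = lookup p j"
    by (simp add: lookup_sum in_keys_iff)
qed

lemma lookup_single_mult:
  fixes p :: "'i multiset \<Rightarrow>\<^sub>0 'a::comm_semiring_1"
  shows "lookup (single m c * p) k = (if m \<subseteq># k then c * lookup p (k - m) else 0)"
proof -
  have "(k = m + l) = (m \<subseteq># k \<and> l = k - m)" for l
    by auto
  then have "Sum_any (\<lambda>l. lookup p l when k = m + l) = (if m \<subseteq># k then lookup p (k - m) else 0)"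
    by (cases "m \<subseteq># k") simp_all
  then show ?thesis
    by (simp add: lookup_mult lookup_single when_mult)
qed

lemma single_power:
  fixes c :: "'a::comm_semiring_1"
  shows "single m c ^ n = single (repeat_mset n m) (c ^ n)"
  by (induction n) (simp_all add: mult_single)

lemma repeat_mset_single: "repeat_mset n {#i#} = replicate_mset n i"
  by (rule multiset_eqI) simp

text \<open>Polynomials are elements of the monoid algebra of \<open>'i multiset\<close>: the exponent of a monomial is
  the multiset of its variables.\<close>

definition vars_in :: "'i set \<Rightarrow> ('i multiset \<Rightarrow>\<^sub>0 'a::zero) \<Rightarrow> bool" where
  "vars_in A p \<longleftrightarrow> (\<forall>m\<in>keys p. set_mset m \<subseteq> A)"

definition homogeneous :: "nat \<Rightarrow> ('i multiset \<Rightarrow>\<^sub>0 'a::zero) \<Rightarrow> bool" where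
  "homogeneous d p \<longleftrightarrow> (\<forall>m\<in>keys p. size m = d)"

lemma vars_inD: "vars_in A p \<Longrightarrow> lookup p m \<noteq> 0 \<Longrightarrow> i \<in># m \<Longrightarrow> i \<in> A"
  by (auto simp: vars_in_def in_keys_iff)

lemma vars_in_mult:
  "vars_in A p \<Longrightarrow> vars_in A q \<Longrightarrow> vars_in A (p * q)"
  using keys_mult[of p q] by (fastforce simp: vars_in_def)

lemma vars_in_prod_list:
  fixes f :: "'c \<Rightarrow> ('i multiset \<Rightarrow>\<^sub>0 'a::comm_semiring_1)"
  assumes "\<And>x. x \<in> set xs \<Longrightarrow> vars_in A (f x)"
  shows "vars_in A (\<Prod>x\<leftarrow>xs. f x)"
  using assms
proof (induction xs)
  case (Cons x xs)
  then show ?case by (simp add: vars_in_mult)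
qed (simp add: vars_in_def)

lemma vars_in_sum:
  "(\<And>x. x \<in> S \<Longrightarrow> vars_in A (f x)) \<Longrightarrow> vars_in A (\<Sum>x\<in>S. f x)"
  using keys_sum[of f S] by (fastforce simp: vars_in_def)

lemma homogeneous_sum:
  "(\<And>x. x \<in> S \<Longrightarrow> homogeneous d (f x)) \<Longrightarrow> homogeneous d (\<Sum>x\<in>S. f x)"
  using keys_sum[of f S] by (fastforce simp: homogeneous_def)

lemma homogeneous_mult:
  "homogeneous d p \<Longrightarrow> homogeneous e q \<Longrightarrow> homogeneous (d + e) (p * q)"
  using keys_mult[of p q] by (fastforce simp: homogeneous_def)

lemma homogeneous_prod_list:
  fixes f :: "'c \<Rightarrow> ('i multiset \<Rightarrow>\<^sub>0 'a::comm_semiring_1)"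
  assumes "\<And>x. x \<in> set xs \<Longrightarrow> homogeneous 1 (f x)"
  shows "homogeneous (length xs) (\<Prod>x\<leftarrow>xs. f x)"
  using assms
proof (induction xs)
  case (Cons x xs)
  then have "homogeneous (1 + length xs) (f x * (\<Prod>x\<leftarrow>xs. f x))"
    by (intro homogeneous_mult) auto
  then show ?case by simp
qed (simp add: homogeneous_def)

text \<open>Frobenius is additive and fixes all coefficients, since they lie in the field with q
  elements; only the exponents change.\<close>

lemma power_card_power_poly_mapping:
  fixes p :: "'i multiset \<Rightarrow>\<^sub>0 'a::{field,finite}"
  shows "p ^ (CARD('a) ^ e) = (\<Sum>m\<in>keys p. single (repeat_mset (CARD('a) ^ e) m) (lookup p m))"
proof -
  let ?Q = "CARD('a) ^ e"
  have "of_nat (CARD('a) choose k) = (0 :: 'i multiset \<Rightarrow>\<^sub>0 'a)" if "0 < k" "k < CARD('a)" for k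
    using of_nat_card_choose_eq_0[OF that] by (metis single_of_nat single_zero)
  then have add: "(x + y) ^ ?Q = x ^ ?Q + y ^ ?Q" for x y :: "'i multiset \<Rightarrow>\<^sub>0 'a"
    by (rule add_power_power_of_choose_eq_0) auto
  have "(\<Sum>m\<in>S. single m (lookup p m)) ^ ?Q = (\<Sum>m\<in>S. single (repeat_mset ?Q m) (lookup p m))"
    if "finite S" for S
    using that by induction (simp_all add: add zero_power single_power power_card_power_eq)
  from this[of "keys p"] show ?thesis
    by (simp add: sum_single_lookup)
qed

text \<open>Modulo \<open>Q\<close>, the exponents of \<open>P\<close> that contribute are \<open>-1\<close> at each element of \<open>A\<close>, hence at least \<open>Q - 1\<close>;
  by homogeneity they are equal to \<open>Q - 1\<close>.\<close>

lemma lookup_power_mult: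
  fixes G P :: "'i multiset \<Rightarrow>\<^sub>0 'a::{field,finite}"
  assumes "finite A" and Q: "Q = CARD('a) ^ e" and hom: "homogeneous (card A * (Q - 1)) P"
    and R: "R = (\<Sum>j\<in>A. replicate_mset (Q - 1) j)"
  shows "lookup (G ^ Q * P) (repeat_mset Q M + R) = lookup G M * lookup P R"
proof -
  have "Q > 0" by (simp add: Q)
  have count_R: "count R j = (if j \<in> A then Q - 1 else 0)" for j
    using \<open>finite A\<close> by (simp add: R count_sum)
  have unique: "b = R \<and> a = M" if eq: "repeat_mset Q a + b = repeat_mset Q M + R" and "b \<in> keys P" for a b
  proof -
    have count_eq: "Q * count a j + count b j = Q * count M j + count R j" for j
      using arg_cong[OF eq, of "\<lambda>m. count m j"] by simp
    have ge: "Q - 1 \<le> count b j" if "j \<in> A" for j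
    proof -
      have "(Q * count a j + count b j) mod Q = (Q * count M j + (Q - 1)) mod Q"
        using count_eq[of j] that by (simp add: count_R)
      then have "count b j mod Q = Q - 1"
        using \<open>Q > 0\<close> by (simp only: mod_mult_self4) simp
      then show ?thesis
        by (metis mod_less_eq_dividend)
    qed
    have "R \<subseteq># b"
      by (rule mset_subset_eqI) (use ge in \<open>auto simp: count_R\<close>)
    moreover have "size R = size b"
      using hom \<open>b \<in> keys P\<close> by (simp add: homogeneous_def R size_multiset_sum)
    ultimately have "b = R"
      by (metis mset_subset_size order_less_irrefl subset_mset.le_imp_less_or_eq)
    with eq have "repeat_mset Q a = repeat_mset Q M" by simp
    then have "a = M"
      using \<open>Q > 0\<close> by (simp add: repeat_mset_cancel1)
    with \<open>b = R\<close> show ?thesis by simp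
  qed
  have "lookup (G ^ Q * P) (repeat_mset Q M + R) =
      (\<Sum>a\<in>keys G. lookup (single (repeat_mset Q a) (lookup G a) * P) (repeat_mset Q M + R))"
    by (simp add: Q power_card_power_poly_mapping sum_distrib_right lookup_sum)
  also have "\<dots> = (\<Sum>a\<in>keys G. if a = M then lookup G a * lookup P R else 0)"
  proof (intro sum.cong refl)
    fix a assume "a \<in> keys G"
    show "lookup (single (repeat_mset Q a) (lookup G a) * P) (repeat_mset Q M + R) =
        (if a = M then lookup G a * lookup P R else 0)"
      using unique[of a "repeat_mset Q M + R - repeat_mset Q a"]
      by (auto simp: lookup_single_mult in_keys_iff)
  qed
  also have "\<dots> = lookup G M * lookup P R"
    by (simp add: in_keys_iff)
  finally show ?thesis .
qed

section \<open>Splittings of a list\<close>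

text \<open>The unshuffle coproduct, dual to \<open>riffles\<close>. Splittings are counted by
  positions, so equal entries give repeated pairs.\<close>

fun unriffles :: "'c list \<Rightarrow> ('c list \<times> 'c list) list" where
  "unriffles [] = [([], [])]"
| "unriffles (x # xs) =
     map (\<lambda>(ps, qs). (x # ps, qs)) (unriffles xs) @ map (\<lambda>(ps, qs). (ps, x # qs)) (unriffles xs)"

lemma set_unriffles:
  "(ps, qs) \<in> set (unriffles xs) \<Longrightarrow> set ps \<subseteq> set xs \<and> set qs \<subseteq> set xs"
  by (induction xs arbitrary: ps qs) fastforce+

lemma prod_list_add:
  fixes f g :: "'c \<Rightarrow> 'r::comm_semiring_1"
  shows "(\<Prod>x\<leftarrow>xs. f x + g x) = (\<Sum>(ps, qs)\<leftarrow>unriffles xs. (\<Prod>x\<leftarrow>ps. f x) * (\<Prod>x\<leftarrow>qs. g x))"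
  by (induction xs)
    (simp_all add: algebra_simps case_prod_beta o_def sum_list_addf flip: sum_list_const_mult)

text \<open>The default 0 for unequal lengths allows sums over all splittings of the forms without a
  condition on lengths.\<close>

fun word_form :: "('b \<Rightarrow> 'a::comm_semiring_1) list \<Rightarrow> 'b list \<Rightarrow> 'a" where
  "word_form [] [] = 1"
| "word_form (l # ls) (x # xs) = l x * word_form ls xs"
| "word_form _ _ = 0"

lemma word_form_eq_0: "length ls \<noteq> length xs \<Longrightarrow> word_form ls xs = 0"
  by (induction ls xs rule: word_form.induct) auto

lemma word_form_replicate:
  "word_form ls (replicate n x) = (if length ls = n then \<Prod>l\<leftarrow>ls. l x else 0)"
proof (induction ls arbitrary: n)
  case Nil
  then show ?case by (cases n) auto
next
  case (Cons l ls)
  then show ?case by (cases n) auto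
qed

lemma word_form_eq_prod:
  "length ls = length xs \<Longrightarrow> word_form ls xs = (\<Prod>i<length xs. (ls ! i) (xs ! i))"
  by (induction ls xs rule: word_form.induct) (simp_all add: prod.lessThan_Suc_shift del: prod.lessThan_Suc)

lemma riffles_Nil2: "riffles xs [] = [xs]"
  by (cases xs) simp_all

text \<open>Duality of shuffle product and unshuffle coproduct. By induction on the forms: the first
  form is applied either to the head of \<open>xs\<close> or to the head of
  \<open>ys\<close>.\<close>

lemma sum_word_form_riffles:
  "(\<Sum>zs\<leftarrow>riffles xs ys. word_form ls zs) =
    (\<Sum>(ps, qs)\<leftarrow>unriffles ls. word_form ps xs * word_form qs ys)"
proof (induction ls arbitrary: xs ys)
  case Nil
  then show ?case
    by (cases xs; cases ys) (auto simp: o_def word_form_eq_0 length_shuffles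
        intro!: sum_list_0 simp flip: set_riffles)
next
  case (Cons l ls)
  have nil: "(\<Sum>(ps, qs)\<leftarrow>unriffles ls. word_form (l # ps) [] * word_form qs ys) = 0"
    and nil': "(\<Sum>(ps, qs)\<leftarrow>unriffles ls. word_form ps xs * word_form (l # qs) []) = 0" for xs ys :: "'b list"
    by (simp_all add: case_prod_unfold)
  have hd: "(\<Sum>(ps, qs)\<leftarrow>unriffles ls. word_form (l # ps) (x # xs) * word_form qs ys) =
      l x * (\<Sum>zs\<leftarrow>riffles xs ys. word_form ls zs)"
    and hd': "(\<Sum>(ps, qs)\<leftarrow>unriffles ls. word_form ps xs * word_form (l # qs) (x # ys)) =
      l x * (\<Sum>zs\<leftarrow>riffles xs ys. word_form ls zs)" for x xs ys
    by (simp_all add: Cons case_prod_unfold ac_simps flip: sum_list_const_mult)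
  have split: "(\<Sum>(ps, qs)\<leftarrow>unriffles (l # ls). word_form ps xs * word_form qs ys) =
    (\<Sum>(ps, qs)\<leftarrow>unriffles ls. word_form (l # ps) xs * word_form qs ys) +
    (\<Sum>(ps, qs)\<leftarrow>unriffles ls. word_form ps xs * word_form (l # qs) ys)"
    by (simp add: case_prod_unfold o_def)
  show ?case
    unfolding split
    by (cases xs; cases ys; simp only: nil nil' hd hd'; simp add: riffles_Nil2 o_def sum_list_const_mult)
qed

section \<open>Multilinear forms on tensor powers\<close>

lemma sum_sum_list_swap:
  fixes f :: "'k \<Rightarrow> 'x \<Rightarrow> 'r::comm_monoid_add"
  shows "(\<Sum>k\<in>K. \<Sum>x\<leftarrow>xs. f k x) = (\<Sum>x\<leftarrow>xs. \<Sum>k\<in>K. f k x)"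
  by (induction xs) (simp_all add: sum.distrib)

lemma subspace_free_on:
  fixes K :: "'k set"
  shows "free.subspace (free_on K :: ('k \<Rightarrow>\<^sub>0 'a::field) set)"
proof (rule free.subspaceI)
  fix p q :: "'k \<Rightarrow>\<^sub>0 'a" and c
  assume "p \<in> free_on K"
  then show "free_scale c p \<in> free_on K"
    by (auto simp: free_on_def in_keys_iff)
  assume "q \<in> free_on K"
  with \<open>p \<in> free_on K\<close> show "p + q \<in> free_on K"
    using keys_add[of p q] by (auto simp: free_on_def)
qed (simp add: free_on_def)

lemma free_lift_superset:
  assumes "finite K" "keys p \<subseteq> K"
  shows "free_lift h p = (\<Sum>k\<in>K. free_scale (lookup p k) (h k))"
  unfolding free_lift_def by (intro sum.mono_neutral_left) (use assms in \<open>auto simp: in_keys_iff\<close>)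

lemma free_lift_add: "free_lift h (p + q) = free_lift h p + free_lift h q"
  using keys_add[of p q]
  by (simp add: free_lift_superset[of "keys p \<union> keys q"] lookup_add free.scale_left_distrib sum.distrib)

lemma free_lift_scale: "free_lift h (free_scale c p) = free_scale c (free_lift h p)"
proof -
  have "keys (free_scale c p) \<subseteq> keys p"
    by (auto simp: in_keys_iff)
  then show ?thesis
    by (simp add: free_lift_superset[of "keys p"] free.scale_sum_right)
qed

lemma free_lift_in_free_on:
  assumes "\<And>k. k \<in> keys p \<Longrightarrow> h k \<in> free_on K"
  shows "free_lift h p \<in> free_on K"
  unfolding free_lift_def
  by (intro free.subspace_sum free.subspace_scale subspace_free_on assms)

definition form :: "('b \<Rightarrow> 'a::field) list \<Rightarrow> ('b list \<Rightarrow>\<^sub>0 'a) \<Rightarrow> 'a" where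
  "form ls p = (\<Sum>xs\<in>keys p. lookup p xs * word_form ls xs)"

lemma form_superset:
  assumes "finite K" "keys p \<subseteq> K"
  shows "form ls p = (\<Sum>xs\<in>K. lookup p xs * word_form ls xs)"
  unfolding form_def by (intro sum.mono_neutral_left) (use assms in \<open>auto simp: in_keys_iff\<close>)

lemma form_0 [simp]: "form ls 0 = 0"
  by (simp add: form_def)

lemma form_single [simp]: "form ls (single xs c) = c * word_form ls xs"
  by (cases "c = 0") (simp_all add: form_def)

lemma form_add: "form ls (p + q) = form ls p + form ls q"
  using keys_add[of p q]
  by (simp add: form_superset[of "keys p \<union> keys q"] lookup_add algebra_simps sum.distrib)

lemma form_scale [simp]: "form ls (free_scale c p) = c * form ls p"
proof -
  have "keys (free_scale c p) \<subseteq> keys p"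
    by (auto simp: in_keys_iff)
  then show ?thesis
    by (simp add: form_superset[of "keys p"] sum_distrib_left mult.assoc)
qed

lemma form_diff: "form ls (p - q) = form ls p - form ls q"
  using form_add[of ls "p - q" q] by simp

lemma form_sum: "form ls (\<Sum>x\<in>X. f x) = (\<Sum>x\<in>X. form ls (f x))"
  by (induction X rule: infinite_finite_induct) (simp_all add: form_add)

lemma form_sum_list: "form ls (\<Sum>x\<leftarrow>xs. f x) = (\<Sum>x\<leftarrow>xs. form ls (f x))"
  by (induction xs) (simp_all add: form_add)

lemma form_free_lift: "form ls (free_lift h p) = (\<Sum>k\<in>keys p. lookup p k * form ls (h k))"
  by (simp add: free_lift_def form_sum)

lemma form_free_shuffle:
  "form ls (free_shuffle p q) = (\<Sum>(ps, qs)\<leftarrow>unriffles ls. form ps p * form qs q)"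
proof -
  have "form ls (free_shuffle p q) =
      (\<Sum>xs\<in>keys p. lookup p xs * (\<Sum>ys\<in>keys q. lookup q ys *
        (\<Sum>(ps, qs)\<leftarrow>unriffles ls. word_form ps xs * word_form qs ys)))"
    by (simp add: free_shuffle_def form_free_lift form_sum_list sum_word_form_riffles)
  also have "\<dots> = (\<Sum>(ps, qs)\<leftarrow>unriffles ls. \<Sum>xs\<in>keys p. \<Sum>ys\<in>keys q.
        (lookup p xs * word_form ps xs) * (lookup q ys * word_form qs ys))"
    by (simp add: case_prod_unfold sum_sum_list_swap sum_distrib_left mult_ac flip: sum_list_const_mult)
  also have "\<dots> = (\<Sum>(ps, qs)\<leftarrow>unriffles ls. form ps p * form qs q)"
    by (simp add: form_def sum_product)
  finally show ?thesis .
qed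

lemma word_form_append:
  "word_form ls (xs @ ys) = word_form (take (length xs) ls) xs * word_form (drop (length xs) ls) ys"
proof (induction xs arbitrary: ls)
  case (Cons x xs)
  then show ?case by (cases ls) (simp_all add: mult.assoc)
qed simp

text \<open>The locale restricts the type of scalars to finite fields and adds no further
  assumption; q is \<open>CARD('a)\<close>.\<close>

locale finite_field_vector_space = finite_dimensional_vector_space scale Basis
  for scale :: "'a::{field,finite} \<Rightarrow> 'b::ab_group_add \<Rightarrow> 'b" (infixr \<open>*s\<close> 75)
    and Basis :: "'b set"
begin

abbreviation linear_form :: "('b \<Rightarrow> 'a) \<Rightarrow> bool" where
  "linear_form l \<equiv> Vector_Spaces.linear (*s) (*) l"

lemma linear_formI:
  assumes "\<And>x y. l (x + y) = l x + l y" "\<And>c x. l (c *s x) = c * l x"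
  shows "linear_form l"
  by (unfold_locales) (auto simp: assms algebra_simps)

lemma linear_form_add: "linear_form l \<Longrightarrow> l (x + y) = l x + l y"
  by (rule module_hom.add) (rule module_hom_linearI)

lemma linear_form_scale: "linear_form l \<Longrightarrow> l (c *s x) = c * l x"
  by (rule module_hom.scale) (rule module_hom_linearI)

lemma subspace_words: "free.subspace (words n)"
  by (simp add: words_def subspace_free_on)

lemma single_in_words [simp]: "length xs = n \<Longrightarrow> single xs c \<in> words n"
  by (simp add: words_def free_on_def)

lemma free_lift_in_words:
  "(\<And>k. k \<in> keys p \<Longrightarrow> h k \<in> words n) \<Longrightarrow> free_lift h p \<in> words n"
  unfolding words_def by (rule free_lift_in_free_on)

lemma length_of_words: "p \<in> words n \<Longrightarrow> xs \<in> keys p \<Longrightarrow> length xs = n"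
  by (auto simp: words_def free_on_def)

lemma free_shuffle_in_words:
  assumes "p \<in> words m" "q \<in> words n"
  shows "free_shuffle p q \<in> words (m + n)"
  unfolding free_shuffle_def
proof (intro free_lift_in_words)
  fix xs ys assume "xs \<in> keys p" "ys \<in> keys q"
  then have len: "length zs = m + n" if "zs \<in> set (riffles xs ys)" for zs
    using that assms length_shuffles[of zs xs ys] by (simp add: set_riffles length_of_words)
  have "(\<Sum>zs\<leftarrow>zss. single zs 1) \<in> words (m + n)" if "\<forall>zs\<in>set zss. length zs = m + n" for zss
    using that by (induction zss)
      (auto intro: free.subspace_add[OF subspace_words] free.subspace_0[OF subspace_words])
  then show "(\<Sum>zs\<leftarrow>riffles xs ys. single zs 1) \<in> words (m + n)"
    using len by blast
qed

lemma free_permute_in_words: "p \<in> words n \<Longrightarrow> free_permute \<sigma> p \<in> words n"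
  unfolding free_permute_def by (intro free_lift_in_words) (auto dest: length_of_words)

text \<open>Reindexing the product over the positions moves the permutation from the words to the
  forms, so that symmetry of a tensor can be tested as symmetry in the forms.\<close>

lemma form_free_permute:
  assumes \<sigma>: "\<sigma> permutes {..<n}" and "p \<in> words n" and "length ls = n"
  shows "form ls (free_permute \<sigma> p) = form (permute_list (inv \<sigma>) ls) p"
proof -
  have "word_form ls (permute_list \<sigma> xs) = word_form (permute_list (inv \<sigma>) ls) xs" if "length xs = n" for xs
  proof -
    have "word_form ls (permute_list \<sigma> xs) = (\<Prod>i<n. (ls ! i) (xs ! \<sigma> i))"
      using that assms by (simp add: word_form_eq_prod permute_list_nth)
    also have "\<dots> = (\<Prod>i<n. (ls ! inv \<sigma> i) (xs ! i))"
      using prod.permute[OF permutes_inv[OF \<sigma>], of "\<lambda>i. (ls ! i) (xs ! \<sigma> i)"]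
      by (simp add: o_def permutes_inverses(1)[OF \<sigma>])
    also have "\<dots> = word_form (permute_list (inv \<sigma>) ls) xs"
      using that assms permutes_inv[OF \<sigma>] by (simp add: word_form_eq_prod permute_list_nth)
    finally show ?thesis .
  qed
  then show ?thesis
    unfolding free_permute_def form_free_lift form_single unfolding form_def
    using \<open>p \<in> words n\<close> by (simp add: length_of_words)
qed

text \<open>The kernel of \<open>form ls\<close> is a subspace, and it contains the generating
  relations because \<open>word_form\<close> is linear in each position. The list \<open>ls\<close>
  may have any length, which is used for shuffle products.\<close>

lemma form_tensor_relations:
  assumes "p \<in> tensor_relations n" "\<forall>l\<in>set ls. linear_form l"
  shows "form ls p = 0"
proof -
  have add: "word_form ls (us @ (x + y) # ws) = word_form ls (us @ x # ws) + word_form ls (us @ y # ws)"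
    and scale: "word_form ls (us @ (c *s x) # ws) = c * word_form ls (us @ x # ws)" for us ws x y c
  proof -
    have "linear_form (hd (drop (length us) ls))" if "drop (length us) ls \<noteq> []"
      using assms(2) that hd_in_set[OF that] in_set_dropD by fastforce
    \<comment> \<open>If the forms end before this position, every term is 0 by the default of
      \<open>word_form\<close>.\<close>
    then show "word_form ls (us @ (x + y) # ws) = word_form ls (us @ x # ws) + word_form ls (us @ y # ws)"
      and "word_form ls (us @ (c *s x) # ws) = c * word_form ls (us @ x # ws)"
      by (cases "drop (length us) ls";
          simp add: word_form_append linear_form_add linear_form_scale algebra_simps)+
  qed
  have "free.subspace {p. form ls p = 0}"
    by (simp add: free.subspace_def form_add)
  from assms(1)[unfolded tensor_relations_def] this show ?thesis
    by (rule free.span_induct [where P = "\<lambda>p. form ls p = 0"]) (auto simp: form_diff add scale)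
qed

section \<open>Reduction to basis words and separation of tensors by forms\<close>

lemma tensor_relations_sum:
  assumes "finite S" and "length us + Suc (length ws) = n"
  shows "single (us @ (\<Sum>b\<in>S. c b *s b) # ws) 1 - (\<Sum>b\<in>S. free_scale (c b) (single (us @ b # ws) 1))
    \<in> tensor_relations n"
  using assms(1)
proof induction
  case empty
  \<comment> \<open>A word with the letter 0 is a relation: it is the scaling relation for the
    scalar 0.\<close>
  have "single (us @ (0 *s 0) # ws) 1 - free_scale 0 (single (us @ 0 # ws) 1) \<in> tensor_relations n"
    unfolding tensor_relations_def using assms(2) by (intro free.span_base) blast
  then show ?case by simp
next
  case (insert a S)
  let ?y = "\<Sum>b\<in>S. c b *s b"
  have "single (us @ (c a *s a + ?y) # ws) 1 - single (us @ (c a *s a) # ws) 1 - single (us @ ?y # ws) 1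
      \<in> tensor_relations n"
    unfolding tensor_relations_def using assms(2) by (intro free.span_base) blast
  moreover have "single (us @ (c a *s a) # ws) 1 - free_scale (c a) (single (us @ a # ws) 1)
      \<in> tensor_relations n"
    unfolding tensor_relations_def using assms(2) by (intro free.span_base) blast
  \<comment> \<open>The three relations telescope to the claim for
    \<open>insert a S\<close>.\<close>
  ultimately have "(single (us @ (c a *s a + ?y) # ws) 1 - single (us @ (c a *s a) # ws) 1 - single (us @ ?y # ws) 1)
      + (single (us @ (c a *s a) # ws) 1 - free_scale (c a) (single (us @ a # ws) 1))
      + (single (us @ ?y # ws) 1 - (\<Sum>b\<in>S. free_scale (c b) (single (us @ b # ws) 1))) \<in> tensor_relations n"
    using insert.IH unfolding tensor_relations_def by (intro free.span_add)
  then show ?case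
    using insert.hyps by (simp add: algebra_simps)
qed

text \<open>The letters are expanded from left to right; the prefix \<open>us\<close> is the part
  that already consists of basis vectors.\<close>

lemma word_eq_basis_words:
  assumes "set us \<subseteq> Basis" "length us + length xs = n"
  shows "\<exists>p\<in>free_on {ws. length ws = n \<and> set ws \<subseteq> Basis}. single (us @ xs) 1 - p \<in> tensor_relations n"
  using assms
proof (induction xs arbitrary: us)
  case Nil
  then show ?case
    by (intro bexI[of _ "single us 1"]) (auto simp: tensor_relations_def free.span_zero free_on_def)
next
  case (Cons x xs)
  let ?B = "free_on {ws. length ws = n \<and> set ws \<subseteq> Basis} :: ('b list \<Rightarrow>\<^sub>0 'a) set"
  have "\<forall>b\<in>Basis. \<exists>p\<in>?B. single (us @ b # xs) 1 - p \<in> tensor_relations n"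
  proof
    fix b assume "b \<in> Basis"
    then show "\<exists>p\<in>?B. single (us @ b # xs) 1 - p \<in> tensor_relations n"
      using Cons.IH[of "us @ [b]"] Cons.prems by simp
  qed
  from bchoice[OF this[unfolded Bex_def]]
  obtain f where f: "f b \<in> ?B" "single (us @ b # xs) 1 - f b \<in> tensor_relations n" if "b \<in> Basis" for b
    by blast
  define c where "c = representation Basis x"
  have x: "(\<Sum>b\<in>Basis. c b *s b) = x"
    unfolding c_def by (rule sum_representation_eq) (auto simp: independent_Basis span_Basis finite_Basis)
  let ?p = "\<Sum>b\<in>Basis. free_scale (c b) (f b)"
  have "single (us @ x # xs) 1 - (\<Sum>b\<in>Basis. free_scale (c b) (single (us @ b # xs) 1))
      \<in> tensor_relations n"
    using tensor_relations_sum[OF finite_Basis, of us xs n c] Cons.prems by (simp add: x)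
  moreover have "(\<Sum>b\<in>Basis. free_scale (c b) (single (us @ b # xs) 1 - f b)) \<in> tensor_relations n"
    using f(2) unfolding tensor_relations_def by (intro free.span_sum free.span_scale)
  ultimately have "single (us @ x # xs) 1 - ?p \<in> tensor_relations n"
    unfolding tensor_relations_def
    by (drule_tac free.span_add) (auto simp: free.scale_right_diff_distrib sum_subtractf)
  moreover have "?p \<in> ?B"
    by (intro free.subspace_sum free.subspace_scale subspace_free_on f)
  ultimately show ?case by blast
qed

lemma eq_basis_words:
  assumes "p \<in> words n"
  shows "\<exists>p'\<in>free_on {ws. length ws = n \<and> set ws \<subseteq> Basis}. p - p' \<in> tensor_relations n"
proof -
  let ?B = "free_on {ws. length ws = n \<and> set ws \<subseteq> Basis} :: ('b list \<Rightarrow>\<^sub>0 'a) set"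
  have "\<forall>xs\<in>keys p. \<exists>p'\<in>?B. single xs 1 - p' \<in> tensor_relations n"
    using word_eq_basis_words[of "[]" _ n] length_of_words[OF assms] by simp
  from bchoice[OF this[unfolded Bex_def]]
  obtain f where f: "f xs \<in> ?B" "single xs 1 - f xs \<in> tensor_relations n" if "xs \<in> keys p" for xs
    by blast
  have "free_scale c (single xs 1) = single xs c" for c :: 'a and xs :: "'b list"
    by (rule poly_mapping_eqI) (simp add: lookup_single when_def)
  then have "p - free_lift f p = (\<Sum>xs\<in>keys p. free_scale (lookup p xs) (single xs 1 - f xs))"
    by (simp add: free_lift_def free.scale_right_diff_distrib sum_subtractf sum_single_lookup)
  also have "\<dots> \<in> tensor_relations n"
    using f(2) unfolding tensor_relations_def by (intro free.span_sum free.span_scale)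
  finally show ?thesis
    using free_lift_in_free_on[of p f, OF f(1)] by blast
qed

lemma linear_form_representation:
  assumes "independent B" "span B = UNIV"
  shows "linear_form (\<lambda>v. representation B v b)"
  by (rule linear_formI) (auto simp: representation_add representation_scale assms)

lemma word_form_dual_basis:
  assumes "set xs \<subseteq> Basis" "length xs = length ws"
  shows "word_form (map (\<lambda>b v. representation Basis v b) ws) xs = (if xs = ws then 1 else 0)"
  using assms(2,1) by (induction xs ws rule: list_induct2) (auto simp: representation_basis independent_Basis)

text \<open>Modulo the relations every element is a combination of basis words, and tensor products
  of coordinate forms isolate its coefficients. Identities between classes thereby become identities
  between scalars.\<close>

lemma tensor_eq_iff:
  "(p, q) \<in> tensor_eq n \<longleftrightarrow> p \<in> words n \<and> q \<in> words n \<and>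
    (\<forall>ls. length ls = n \<longrightarrow> (\<forall>l\<in>set ls. linear_form l) \<longrightarrow> form ls p = form ls q)"
proof -
  have "p - q \<in> tensor_relations n"
    if "p \<in> words n" "q \<in> words n"
      and forms: "\<And>ls. length ls = n \<Longrightarrow> \<forall>l\<in>set ls. linear_form l \<Longrightarrow> form ls p = form ls q"
  proof -
    have "p - q \<in> words n"
      using that free.subspace_diff[OF subspace_words] by blast
    then obtain r where r: "r \<in> free_on {ws. length ws = n \<and> set ws \<subseteq> Basis}"
      "p - q - r \<in> tensor_relations n"
      using eq_basis_words by blast
    have keys_r: "length xs = n" "set xs \<subseteq> Basis" if "xs \<in> keys r" for xs
      using r(1) that by (auto simp: free_on_def)
    have "lookup r ws = 0" if "ws \<in> keys r" for ws
    proof -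
      let ?ls = "map (\<lambda>b v. representation Basis v b) ws"
      have lin: "\<forall>l\<in>set ?ls. linear_form l"
        using linear_form_representation[OF independent_Basis span_Basis] by auto
      have "form ?ls r = (\<Sum>xs\<in>keys r. if xs = ws then lookup r xs else 0)"
        unfolding form_def using keys_r that by (intro sum.cong refl) (simp add: word_form_dual_basis)
      then have "form ?ls r = lookup r ws"
        by (simp add: that)
      moreover have "form ?ls (p - q - r) = 0"
        using r(2) lin by (rule form_tensor_relations)
      ultimately show ?thesis
        using forms[OF _ lin] keys_r(1)[OF that] by (simp add: form_diff)
    qed
    then have "r = 0"
      by (intro poly_mapping_eqI) (auto simp: in_keys_iff)
    with r(2) show ?thesis by simp
  qed
  moreover have "form ls p = form ls q"
    if "p - q \<in> tensor_relations n" "\<forall>l\<in>set ls. linear_form l" for ls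
    using form_tensor_relations[OF that] by (simp add: form_diff)
  ultimately have "p - q \<in> tensor_relations n \<longleftrightarrow>
      (\<forall>ls. length ls = n \<longrightarrow> (\<forall>l\<in>set ls. linear_form l) \<longrightarrow> form ls p = form ls q)"
    if "p \<in> words n" "q \<in> words n"
    using that by meson
  then show ?thesis
    by (simp add: tensor_eq_def cong: conj_cong)
qed

end

section \<open>Generating functions of shuffle products\<close>

lemma prod_list_single:
  fixes f :: "'c \<Rightarrow> 'a::comm_semiring_1"
  shows "(\<Prod>x\<leftarrow>xs. single {#i#} (f x)) = single (replicate_mset (length xs) i) (\<Prod>x\<leftarrow>xs. f x)"
  by (induction xs) (simp_all add: mult_single)

lemma prod_list_const_mult:
  fixes f :: "'c \<Rightarrow> 'a::comm_semiring_1"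
  shows "(\<Prod>x\<leftarrow>xs. c * f x) = c ^ length xs * (\<Prod>x\<leftarrow>xs. f x)"
  by (induction xs) (simp_all add: ac_simps)

text \<open>Representatives in the free space for \<open>pure_power_product\<close>, as
  \<open>pure_power_product_class\<close> shows.\<close>

fun power_product :: "nat list \<Rightarrow> 'b list \<Rightarrow> ('b list \<Rightarrow>\<^sub>0 'a::field)" where
  "power_product (n # ns) (v # vs) = free_shuffle (single (replicate n v) 1) (power_product ns vs)"
| "power_product _ _ = single [] 1"

text \<open>The value of the linear form \<open>l\<close> at the vector \<open>\<Sum>j\<in>J. t\<^sub>j v\<^sub>j\<close>, where the \<open>t\<^sub>j\<close> are indeterminates.\<close>

definition generic_value :: "'i set \<Rightarrow> ('i \<Rightarrow> 'b) \<Rightarrow> ('b \<Rightarrow> 'a) \<Rightarrow> ('i multiset \<Rightarrow>\<^sub>0 'a::comm_semiring_1)" where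
  "generic_value J v l = (\<Sum>j\<in>J. single {#j#} (l (v j)))"

text \<open>By \<open>form_power_product\<close> this is the value of the forms at a divided power
  product. Unlike that product, it depends on no order of the indices, and it is visibly symmetric
  in the forms.\<close>

definition flag_coeff :: "'i set \<Rightarrow> ('i \<Rightarrow> nat) \<Rightarrow> ('i \<Rightarrow> 'b) \<Rightarrow> ('b \<Rightarrow> 'a::comm_semiring_1) list \<Rightarrow> 'a" where
  "flag_coeff J n v ls = lookup (\<Prod>l\<leftarrow>ls. generic_value J v l) (\<Sum>j\<in>J. replicate_mset (n j) j)"

lemma generic_value_insert:
  "finite J \<Longrightarrow> j \<notin> J \<Longrightarrow> generic_value (insert j J) v l = single {#j#} (l (v j)) + generic_value J v l"
  by (simp add: generic_value_def)

lemma generic_value_cong: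
  "(\<And>j. j \<in> J \<Longrightarrow> v j = w j) \<Longrightarrow> generic_value J v l = generic_value J w l"
  by (simp add: generic_value_def)

lemma vars_in_generic_value: "J \<subseteq> A \<Longrightarrow> vars_in A (generic_value J v l)"
  unfolding generic_value_def by (intro vars_in_sum) (auto simp: vars_in_def)

lemma homogeneous_generic_value: "homogeneous 1 (generic_value J v l)"
  unfolding generic_value_def by (intro homogeneous_sum) (auto simp: homogeneous_def)

text \<open>Each splitting says which factors contribute their t_j term. Fewer than n_j of them
  leave some t_j to the other factors, where it does not occur; more than n_j exceed the
  exponent.\<close>

lemma flag_coeff_insert:
  assumes "finite J" "j \<notin> J"
  shows "flag_coeff (insert j J) n v ls =
    (\<Sum>(ps, qs)\<leftarrow>unriffles ls. (if length ps = n j then \<Prod>l\<leftarrow>ps. l (v j) else 0) * flag_coeff J n v qs)"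
proof -
  let ?M = "\<Sum>j\<in>J. replicate_mset (n j) j"
  have count_M: "count ?M j = 0"
    using assms by (simp add: count_sum)
  have *: "lookup ((\<Prod>l\<leftarrow>ps. single {#j#} (l (v j))) * (\<Prod>l\<leftarrow>qs. generic_value J v l)) (replicate_mset (n j) j + ?M) =
      (if length ps = n j then \<Prod>l\<leftarrow>ps. l (v j) else 0) * flag_coeff J n v qs" for ps qs
  proof -
    have vars: "vars_in J (\<Prod>l\<leftarrow>qs. generic_value J v l)"
      by (intro vars_in_prod_list vars_in_generic_value) simp
    let ?R = "replicate_mset (n j) j + ?M"
    have count_R: "count ?R j = n j"
      using count_M by simp
    have expand: "lookup ((\<Prod>l\<leftarrow>ps. single {#j#} (l (v j))) * (\<Prod>l\<leftarrow>qs. generic_value J v l)) ?R =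
        (if replicate_mset (length ps) j \<subseteq># ?R
         then (\<Prod>l\<leftarrow>ps. l (v j)) * lookup (\<Prod>l\<leftarrow>qs. generic_value J v l) (?R - replicate_mset (length ps) j)
         else 0)"
      by (simp only: prod_list_single lookup_single_mult)
    consider "length ps < n j" | "length ps = n j" | "length ps > n j" by linarith
    then show ?thesis
    proof cases
      case 1
      then have "j \<in># ?R - replicate_mset (length ps) j"
        using count_R by (simp add: count_greater_zero_iff [symmetric] del: count_greater_zero_iff)
      then have "lookup (\<Prod>l\<leftarrow>qs. generic_value J v l) (?R - replicate_mset (length ps) j) = 0"
        using vars_inD[OF vars] \<open>j \<notin> J\<close> by blast
      with 1 show ?thesis
        unfolding expand by simp
    next
      case 2
      then show ?thesis
        unfolding expand by (simp add: flag_coeff_def)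
    next
      case 3
      then have "\<not> replicate_mset (length ps) j \<subseteq># ?R"
        using count_R mset_subset_eq_count[of "replicate_mset (length ps) j" ?R j] by auto
      with 3 show ?thesis
        unfolding expand by simp
    qed
  qed
  have "flag_coeff (insert j J) n v ls =
      lookup (\<Prod>l\<leftarrow>ls. single {#j#} (l (v j)) + generic_value J v l) (replicate_mset (n j) j + ?M)"
    using assms by (simp add: flag_coeff_def generic_value_def)
  also have "\<dots> = (\<Sum>(ps, qs)\<leftarrow>unriffles ls.
      lookup ((\<Prod>l\<leftarrow>ps. single {#j#} (l (v j))) * (\<Prod>l\<leftarrow>qs. generic_value J v l)) (replicate_mset (n j) j + ?M))"
    by (simp add: prod_list_add lookup_sum_list o_def case_prod_unfold)
  finally show ?thesis
    by (simp add: *)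
qed

text \<open>Both sides obey the same recursion over the splittings of the forms.\<close>

lemma form_power_product:
  "distinct js \<Longrightarrow> form ls (power_product (map n js) (map v js)) = flag_coeff (set js) n v ls"
proof (induction js arbitrary: ls)
  case Nil
  then show ?case
    by (cases ls) (simp_all add: flag_coeff_def generic_value_def)
next
  case (Cons j js)
  then show ?case
    by (simp add: form_free_shuffle flag_coeff_insert word_form_replicate)
qed

lemma flag_coeff_cong_mset: "mset ls = mset ls' \<Longrightarrow> flag_coeff J n v ls = flag_coeff J n v ls'"
  unfolding flag_coeff_def prod_mset_prod_list [symmetric] mset_map by simp

lemma replicate_mset_add: "replicate_mset (m + n) i = replicate_mset m i + replicate_mset n i"
  by (rule multiset_eqI) simp

text \<open>In the binomial expansion the b-th term has t_i-exponent x + b and t_j-exponent y - b,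
  while \<open>Z\<close> contains neither variable. If it contributes, then y = n_j + b, where n_i
  and n_j are the exponents in \<open>M\<close>, and the binomial coefficient vanishes for b > 0.
  For b = 0 one has x = n_i, and c^x = 1.\<close>

lemma lookup_shear:
  fixes Z :: "'i multiset \<Rightarrow>\<^sub>0 'a::comm_ring_1"
  assumes Z: "vars_in K Z" "i \<notin> K" "j \<notin> K" and "i \<noteq> j"
    and c: "c ^ count M i = 1"
    and carry: "\<And>b. 0 < b \<Longrightarrow> b \<le> count M i \<Longrightarrow> of_nat (count M j + b choose b) = (0 :: 'a)"
  shows "lookup (single {#i#} c ^ x * (single {#i#} d + single {#j#} 1) ^ y * Z) M =
    lookup (single {#i#} 1 ^ x * single {#j#} 1 ^ y * Z) M"
proof -
  define m where "m b = replicate_mset (x + b) i + replicate_mset (y - b) j" for b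
  have supp: "x + b = count M i \<and> y - b = count M j" if "lookup (single (m b) 1 * Z) M \<noteq> 0" for b
  proof -
    have "m b \<subseteq># M" "lookup Z (M - m b) \<noteq> 0"
      using that by (auto simp: lookup_single_mult split: if_splits)
    moreover from this have "count (M - m b) i = 0" "count (M - m b) j = 0"
      using vars_inD[OF Z(1)] Z(2,3) by (meson not_in_iff)+
    ultimately have "count (m b) i = count M i" "count (m b) j = count M j"
      using mset_subset_eq_count[of "m b" M] by (simp_all add: le_antisym)
    then show ?thesis
      using \<open>i \<noteq> j\<close> by (simp add: m_def)
  qed
  have scale: "lookup (single (m b) e * Z) M = e * lookup (single (m b) 1 * Z) M" for b e
    by (simp add: lookup_single_mult)
  have "single {#i#} c ^ x * (single {#i#} d + single {#j#} 1) ^ y * Z =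
      (\<Sum>b\<le>y. single (m b) (c ^ x * of_nat (y choose b) * d ^ b) * Z)"
    unfolding binomial_ring sum_distrib_left sum_distrib_right
  proof (intro sum.cong refl)
    fix b
    have "single {#i#} c ^ x * (of_nat (y choose b) * single {#i#} d ^ b * single {#j#} 1 ^ (y - b)) =
        single (m b) (c ^ x * of_nat (y choose b) * d ^ b)"
      by (simp add: single_power repeat_mset_single mult_single m_def replicate_mset_add ac_simps
          flip: single_of_nat)
    then show "single {#i#} c ^ x * (of_nat (y choose b) * single {#i#} d ^ b * single {#j#} 1 ^ (y - b)) * Z =
        single (m b) (c ^ x * of_nat (y choose b) * d ^ b) * Z" by simp
  qed
  then have "lookup (single {#i#} c ^ x * (single {#i#} d + single {#j#} 1) ^ y * Z) M =
      (\<Sum>b\<le>y. lookup (single (m b) (c ^ x * of_nat (y choose b) * d ^ b) * Z) M)"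
    by (simp add: lookup_sum)
  also have "\<dots> = (\<Sum>b\<le>y. if b = 0 then lookup (single (m b) 1 * Z) M else 0)"
  proof (intro sum.cong refl)
    fix b assume "b \<in> {..y}"
    show "lookup (single (m b) (c ^ x * of_nat (y choose b) * d ^ b) * Z) M =
        (if b = 0 then lookup (single (m b) 1 * Z) M else 0)"
      unfolding scale[of b "c ^ x * of_nat (y choose b) * d ^ b"]
    proof (cases "lookup (single (m b) 1 * Z) M = 0")
      case False
      then have "x + b = count M i" "y - b = count M j"
        using supp by auto
      then have "x + b = count M i" "y = count M j + b"
        using \<open>b \<in> {..y}\<close> by auto
      then show "c ^ x * of_nat (y choose b) * d ^ b * lookup (single (m b) 1 * Z) M =
          (if b = 0 then lookup (single (m b) 1 * Z) M else 0)"
        using c carry[of b] by (cases "b = 0") simp_all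
    qed auto
  qed
  also have "\<dots> = lookup (single {#i#} 1 ^ x * single {#j#} 1 ^ y * Z) M"
    by (simp add: m_def single_power repeat_mset_single mult_single)
  finally show ?thesis .
qed

section \<open>Invariance of the coefficient under changes of the vectors\<close>

context finite_field_vector_space
begin

text \<open>Changing v_i to c v_i + d v_j amounts to the substitution of c t_i for t_i and of d t_i
  + t_j for t_j in the generic values.\<close>

lemma flag_coeff_shear:
  assumes J: "finite J" "i \<in> J" "j \<in> J" "i \<noteq> j"
    and lin: "\<forall>l\<in>set ls. linear_form l"
    and c: "c ^ n i = 1"
    and carry: "\<And>b. 0 < b \<Longrightarrow> b \<le> n i \<Longrightarrow> of_nat (n j + b choose b) = (0 :: 'a)"
  shows "flag_coeff J n (v(i := c *s v i + d *s v j)) ls = flag_coeff J n v ls"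
proof -
  define K where "K = J - {i, j}"
  have K: "finite K" "i \<notin> K" "j \<notin> K" and J_eq: "J = insert i (insert j K)"
    using J by (auto simp: K_def)
  define M where "M = (\<Sum>j\<in>J. replicate_mset (n j) j)"
  have count_M: "count M i = n i" "count M j = n j"
    using J by (simp_all add: M_def count_sum)
  \<comment> \<open>The polynomials \<open>s\<close> and \<open>t\<close> multiply l(v_i) and
    l(v_j). They become c t_i and d t_i + t_j for the changed vectors, t_i and t_j for the original
    ones.\<close>
  have expand: "lookup (\<Prod>l\<leftarrow>ls. s * single {#} (l (v i)) + (t * single {#} (l (v j)) + generic_value K v l)) M =
      (\<Sum>(ps, qs)\<leftarrow>unriffles ls. \<Sum>(rs, us)\<leftarrow>unriffles qs. lookup (s ^ length ps * t ^ length rs *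
        ((\<Prod>l\<leftarrow>ps. single {#} (l (v i))) * (\<Prod>l\<leftarrow>rs. single {#} (l (v j))) * (\<Prod>l\<leftarrow>us. generic_value K v l))) M)"
    for s t :: "'c multiset \<Rightarrow>\<^sub>0 'a"
    by (simp add: prod_list_add lookup_sum_list o_def case_prod_unfold prod_list_const_mult mult_ac
        flip: sum_list_const_mult)
  have terms: "lookup (single {#i#} c ^ x * (single {#i#} d + single {#j#} 1) ^ y *
        ((\<Prod>l\<leftarrow>ps. single {#} (l (v i))) * (\<Prod>l\<leftarrow>rs. single {#} (l (v j))) * (\<Prod>l\<leftarrow>us. generic_value K v l))) M =
      lookup (single {#i#} 1 ^ x * single {#j#} 1 ^ y *
        ((\<Prod>l\<leftarrow>ps. single {#} (l (v i))) * (\<Prod>l\<leftarrow>rs. single {#} (l (v j))) * (\<Prod>l\<leftarrow>us. generic_value K v l))) M"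
    for x y ps rs us
  proof (rule lookup_shear)
    show "vars_in K ((\<Prod>l\<leftarrow>ps. single {#} (l (v i))) * (\<Prod>l\<leftarrow>rs. single {#} (l (v j))) * (\<Prod>l\<leftarrow>us. generic_value K v l))"
      by (intro vars_in_mult vars_in_prod_list vars_in_generic_value) (auto simp: vars_in_def)
  qed (use K J c carry count_M in auto)
  have "generic_value J (v(i := c *s v i + d *s v j)) l =
      single {#i#} c * single {#} (l (v i)) + ((single {#i#} d + single {#j#} 1) * single {#} (l (v j)) + generic_value K v l)"
    if "l \<in> set ls" for l
  proof -
    have "l (c *s v i + d *s v j) = c * l (v i) + d * l (v j)"
      using lin that by (simp add: linear_form_add linear_form_scale)
    moreover have "generic_value K (v(i := c *s v i + d *s v j)) l = generic_value K v l"
      using K by (intro generic_value_cong) auto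
    ultimately show ?thesis
      using K J(4) by (simp add: generic_value_insert J_eq mult_single single_add distrib_right add_ac)
  qed
  then have "(\<Prod>l\<leftarrow>ls. generic_value J (v(i := c *s v i + d *s v j)) l) =
      (\<Prod>l\<leftarrow>ls. single {#i#} c * single {#} (l (v i)) + ((single {#i#} d + single {#j#} 1) * single {#} (l (v j)) + generic_value K v l))"
    by (intro arg_cong[where f = prod_list] map_cong) auto
  moreover have "(\<Prod>l\<leftarrow>ls. generic_value J v l) =
      (\<Prod>l\<leftarrow>ls. single {#i#} 1 * single {#} (l (v i)) + (single {#j#} 1 * single {#} (l (v j)) + generic_value K v l))"
    using K J(4) by (simp add: generic_value_insert J_eq mult_single)
  ultimately show ?thesis
    by (simp only: flag_coeff_def M_def[symmetric] expand terms)
qed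

text \<open>Exactly n_i forms are evaluated at v_i, which yields the factor c^n_i = 1. This is the
  base case of \<open>flag_coeff_add_span\<close>.\<close>

lemma flag_coeff_scale:
  assumes J: "finite J" "i \<in> J" and lin: "\<forall>l\<in>set ls. linear_form l" and c: "c ^ n i = 1"
  shows "flag_coeff J n (v(i := c *s v i)) ls = flag_coeff J n v ls"
proof -
  define K where "K = J - {i}"
  have K: "finite K" "i \<notin> K" "J = insert i K"
    using J by (auto simp: K_def)
  have "generic_value K (v(i := c *s v i)) = (generic_value K v :: ('b \<Rightarrow> 'a) \<Rightarrow> _)"
    using K by (intro ext generic_value_cong) auto
  then have "flag_coeff K n (v(i := c *s v i)) qs = flag_coeff K n v qs" for qs :: "('b \<Rightarrow> 'a) list"
    by (simp add: flag_coeff_def)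
  moreover have "(\<Prod>l\<leftarrow>ps. l (c *s v i)) = (\<Prod>l\<leftarrow>ps. l (v i))"
    if "(ps, qs) \<in> set (unriffles ls)" "length ps = n i" for ps qs
  proof -
    have "(\<Prod>l\<leftarrow>ps. l (c *s v i)) = (\<Prod>l\<leftarrow>ps. c * l (v i))"
      using lin set_unriffles[OF that(1)]
      by (intro arg_cong[where f = prod_list] map_cong) (auto simp: linear_form_scale)
    then show ?thesis
      using c that(2) by (simp add: prod_list_const_mult)
  qed
  ultimately show ?thesis
    unfolding K(3) flag_coeff_insert[OF K(1,2)]
    by (intro arg_cong[where f = sum_list] map_cong) auto
qed

text \<open>The vector \<open>w\<close> is built up term by term, each term by a shear with c = 1.
  Since i is not in \<open>I\<close>, the vectors that are added stay unchanged.\<close>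

lemma flag_coeff_add_span:
  assumes J: "finite J" "i \<in> J" "I \<subseteq> J" "i \<notin> I"
    and lin: "\<forall>l\<in>set ls. linear_form l"
    and c: "c ^ n i = 1"
    and carry: "\<And>b j. j \<in> I \<Longrightarrow> 0 < b \<Longrightarrow> b \<le> n i \<Longrightarrow> of_nat (n j + b choose b) = (0 :: 'a)"
    and w: "w \<in> span (v ` I)"
  shows "flag_coeff J n (v(i := c *s v i + w)) ls = flag_coeff J n v ls"
  using w
proof (induction rule: span_induct_alt)
  case base
  show ?case
    using flag_coeff_scale[of J i ls c n v] assms by (simp add: fun_upd_def)
next
  case (step d x y)
  then obtain k where k: "k \<in> I" "x = v k" by auto
  let ?u = "v(i := c *s v i + y)"
  have "flag_coeff J n (?u(i := 1 *s ?u i + d *s ?u k)) ls = flag_coeff J n ?u ls"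
    by (rule flag_coeff_shear) (use assms k in auto)
  moreover have "?u(i := 1 *s ?u i + d *s ?u k) = v(i := c *s v i + (d *s x + y))"
    using k J(4) by (auto simp: fun_eq_iff)
  ultimately show ?case
    using step.IH by (simp add: fun_upd_def)
qed

section \<open>Operations on classes of tensors\<close>

abbreviation tensor_class :: "nat \<Rightarrow> ('b list \<Rightarrow>\<^sub>0 'a) \<Rightarrow> ('b list \<Rightarrow>\<^sub>0 'a) set" where
  "tensor_class n p \<equiv> tensor_eq n `` {p}"

lemma tensor_class_eqI: "(p, q) \<in> tensor_eq n \<Longrightarrow> tensor_class n p = tensor_class n q"
  by (rule equiv_class_eq[OF equiv_tensor_eq])

lemma tensor_class_eqD:
  "tensor_class n p = tensor_class n q \<Longrightarrow> q \<in> words n \<Longrightarrow> (p, q) \<in> tensor_eq n"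
  by (rule eq_equiv_class[OF _ equiv_tensor_eq])

text \<open>Operations on classes are unions over representatives; such a union collapses once the
  value is independent of the representative.\<close>

lemma UN_tensor_class:
  assumes "p \<in> words n" and "\<And>a. (p, a) \<in> tensor_eq n \<Longrightarrow> f a = c"
  shows "(\<Union>a\<in>tensor_class n p. f a) = c"
proof -
  have "p \<in> tensor_class n p"
    using assms(1) by (simp add: tensor_eq_iff)
  then show ?thesis
    using assms(2) by (intro SUP_eq_const) auto
qed

lemma tensor_add_class:
  assumes "p \<in> words n" "q \<in> words n"
  shows "tensor_add n (tensor_class n p) (tensor_class n q) = tensor_class n (p + q)"
  unfolding tensor_add_def
  using assms by (intro UN_tensor_class tensor_class_eqI)
    (simp_all add: tensor_eq_iff form_add free.subspace_add[OF subspace_words])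

lemma tensor_scale_class:
  assumes "p \<in> words n"
  shows "tensor_scale n c (tensor_class n p) = tensor_class n (free_scale c p)"
  unfolding tensor_scale_def
  using assms by (intro UN_tensor_class tensor_class_eqI)
    (simp_all add: tensor_eq_iff free.subspace_scale[OF subspace_words])

lemma tensor_permute_class:
  assumes "p \<in> words n" "\<sigma> permutes {..<n}"
  shows "tensor_permute n \<sigma> (tensor_class n p) = tensor_class n (free_permute \<sigma> p)"
  unfolding tensor_permute_def
proof (intro UN_tensor_class tensor_class_eqI assms(1))
  fix a assume "(p, a) \<in> tensor_eq n"
  then show "(free_permute \<sigma> a, free_permute \<sigma> p) \<in> tensor_eq n"
    using assms permutes_inv[OF assms(2)]
    by (simp add: tensor_eq_iff free_permute_in_words form_free_permute)
qed

lemma shuffle_product_class: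
  assumes "p \<in> words m" "q \<in> words n"
  shows "shuffle_product m n (tensor_class m p) (tensor_class n q) = tensor_class (m + n) (free_shuffle p q)"
  unfolding shuffle_product_def
proof (intro UN_tensor_class tensor_class_eqI assms)
  \<comment> \<open>No condition on the length of \<open>ls\<close>: a splitting may have parts of
    any lengths.\<close>
  have form_eq: "form ls a = form ls p" if "(p, a) \<in> tensor_eq k" "\<forall>l\<in>set ls. linear_form l" for p a k ls
    using that form_tensor_relations[of "p - a" k ls] by (simp add: tensor_eq_def form_diff)
  fix a b assume ab: "(p, a) \<in> tensor_eq m" "(q, b) \<in> tensor_eq n"
  have "form ls (free_shuffle a b) = form ls (free_shuffle p q)" if "\<forall>l\<in>set ls. linear_form l" for ls
    unfolding form_free_shuffle
  proof (intro arg_cong[where f = sum_list] map_cong refl, clarify)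
    fix ps qs assume "(ps, qs) \<in> set (unriffles ls)"
    from set_unriffles[OF this] that have "\<forall>l\<in>set ps. linear_form l" "\<forall>l\<in>set qs. linear_form l"
      by auto
    then show "form ps a * form qs b = form ps p * form qs q"
      using ab by (simp add: form_eq)
  qed
  then show "(free_shuffle a b, free_shuffle p q) \<in> tensor_eq (m + n)"
    using ab assms by (simp add: tensor_eq_iff free_shuffle_in_words)
qed

lemma tensor_lift_class:
  assumes h: "\<And>k. k \<in> keys x \<Longrightarrow> h k = tensor_class n (\<rho> k)" and \<rho>: "\<And>k. k \<in> keys x \<Longrightarrow> \<rho> k \<in> words n"
  shows "tensor_lift n h x = tensor_class n (free_lift \<rho> x)"
  unfolding tensor_lift_def
proof (rule SUP_eq_const)
  have "\<rho> \<in> Pi (keys x) h"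
    using h \<rho> by (simp add: tensor_eq_iff)
  then show "Pi (keys x) h \<noteq> {}" by blast
next
  fix \<rho>' assume "\<rho>' \<in> Pi (keys x) h"
  then have "(\<rho> k, \<rho>' k) \<in> tensor_eq n" if "k \<in> keys x" for k
    using that h by auto
  then have "(free_lift \<rho> x, free_lift \<rho>' x) \<in> tensor_eq n"
    by (simp add: tensor_eq_iff free_lift_in_words form_free_lift)
  then show "tensor_class n (free_lift \<rho>' x) = tensor_class n (free_lift \<rho> x)"
    by (metis tensor_class_eqI)
qed

lemma power_product_in_words:
  "length ns = length vs \<Longrightarrow> power_product ns vs \<in> words (sum_list ns)"
  by (induction ns vs rule: list_induct2) (simp_all add: free_shuffle_in_words)

lemma pure_power_product_class:
  "length ns = length vs \<Longrightarrow> pure_power_product ns vs = tensor_class (sum_list ns) (power_product ns vs)"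
  by (induction ns vs rule: list_induct2)
    (simp_all add: pure_power_def shuffle_product_class power_product_in_words)

text \<open>Permuting the tensor permutes the forms, and \<open>flag_coeff\<close> depends on their
  multiset only.\<close>

lemma power_product_class_in_divided_power:
  assumes "distinct js"
  shows "tensor_class (sum_list (map n js)) (power_product (map n js) (map v js))
    \<in> divided_power (sum_list (map n js))"
proof -
  let ?N = "sum_list (map n js)" and ?p = "power_product (map n js) (map v js)"
  have p: "?p \<in> words ?N"
    by (rule power_product_in_words) simp
  have "tensor_permute ?N \<sigma> (tensor_class ?N ?p) = tensor_class ?N ?p" if \<sigma>: "\<sigma> permutes {..<?N}" for \<sigma>
  proof -
    have "(free_permute \<sigma> ?p, ?p) \<in> tensor_eq ?N"
      using p permutes_inv[OF \<sigma>]
      by (auto simp: tensor_eq_iff free_permute_in_words form_free_permute[OF \<sigma> p]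
          form_power_product[OF assms] intro!: flag_coeff_cong_mset)
    then show ?thesis
      using p \<sigma> by (simp add: tensor_permute_class tensor_class_eqI)
  qed
  then show ?thesis
    using p by (auto simp: divided_power_def tensor_power_def intro: quotientI)
qed

lemma divided_power_lift:
  assumes "\<And>k. k \<in> keys x \<Longrightarrow> \<rho> k \<in> words n"
    and "\<And>k. k \<in> keys x \<Longrightarrow> tensor_class n (\<rho> k) \<in> divided_power n"
  shows "tensor_class n (free_lift \<rho> x) \<in> divided_power n"
proof -
  have words: "free_lift \<rho> x \<in> words n"
    using assms(1) by (rule free_lift_in_words)
  have "tensor_permute n \<sigma> (tensor_class n (free_lift \<rho> x)) = tensor_class n (free_lift \<rho> x)"
    if \<sigma>: "\<sigma> permutes {..<n}" for \<sigma>
  proof -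
    have "(free_permute \<sigma> (\<rho> k), \<rho> k) \<in> tensor_eq n" if "k \<in> keys x" for k
    proof (rule tensor_class_eqD)
      show "tensor_class n (free_permute \<sigma> (\<rho> k)) = tensor_class n (\<rho> k)"
        using assms that \<sigma> by (simp add: divided_power_def flip: tensor_permute_class)
    qed (use assms that in auto)
    then have "form ls (free_permute \<sigma> (\<rho> k)) = form ls (\<rho> k)"
      if "k \<in> keys x" "length ls = n" "\<forall>l\<in>set ls. linear_form l" for ls k
      using that by (simp add: tensor_eq_iff)
    then have "form ls (free_permute \<sigma> (free_lift \<rho> x)) = form ls (free_lift \<rho> x)"
      if "length ls = n" "\<forall>l\<in>set ls. linear_form l" for ls
      using that assms(1) by (simp add: form_free_permute[OF \<sigma>] words form_free_lift)
    then show ?thesis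
      using words \<sigma> by (simp add: tensor_permute_class tensor_class_eqI tensor_eq_iff free_permute_in_words)
  qed
  then show ?thesis
    using words by (auto simp: divided_power_def tensor_power_def intro: quotientI)
qed

section \<open>Flags and frames\<close>

text \<open>The v_k are replaced by the v'_k one after the other. Equality of the flags gives v'_k =
  c v_k + w with w in the span of the vectors replaced before, and independence gives nonzero
  c.\<close>

lemma flag_coeff_eq_of_flag_eq:
  fixes v v' :: "nat \<Rightarrow> 'b"
  assumes indep: "\<And>k. k \<in> {1..r} \<Longrightarrow> v' k \<notin> span (v' ` {1..<k})"
    and flag: "\<And>k. k \<le> r \<Longrightarrow> span (v ` {1..k}) = span (v' ` {1..k})"
    and antimono: "\<And>i j. 1 \<le> j \<Longrightarrow> j < i \<Longrightarrow> i \<le> r \<Longrightarrow> s i \<le> s j"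
    and lin: "\<forall>l\<in>set ls. linear_form l"
  shows "flag_coeff {1..r} (\<lambda>i. q_bracket CARD('a) (s i)) v ls =
    flag_coeff {1..r} (\<lambda>i. q_bracket CARD('a) (s i)) v' ls"
proof -
  let ?n = "\<lambda>i. q_bracket CARD('a) (s i)"
  \<comment> \<open>The intermediate families: the first k vectors are already replaced.\<close>
  define u where "u k i = (if i \<le> k then v' i else v i)" for k i
  have cong: "flag_coeff {1..r} ?n w ls = flag_coeff {1..r} ?n w' ls" if "\<And>i. i \<in> {1..r} \<Longrightarrow> w i = w' i" for w w'
  proof -
    have "generic_value {1..r} w = (generic_value {1..r} w' :: ('b \<Rightarrow> 'a) \<Rightarrow> _)"
      using that by (intro ext generic_value_cong) auto
    then show ?thesis by (simp add: flag_coeff_def)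
  qed
  have "flag_coeff {1..r} ?n (u k) ls = flag_coeff {1..r} ?n v ls" if "k \<le> r" for k
    using that
  proof (induction k)
    case 0
    show ?case by (rule cong) (simp add: u_def)
  next
    case (Suc k)
    have "v' (Suc k) \<in> span (v ` {1..Suc k})"
      using flag[OF Suc.prems] by (simp add: span_base)
    also have "v ` {1..Suc k} = insert (v (Suc k)) (v ` {1..k})"
      by (simp add: atLeastAtMostSuc_conv)
    finally obtain c where c: "v' (Suc k) - c *s v (Suc k) \<in> span (v ` {1..k})"
      by (auto simp: span_breakdown_eq)
    also have span_eq: "span (v ` {1..k}) = span (v' ` {1..k})"
      using Suc.prems by (intro flag) simp
    also have u_image: "v' ` {1..k} = u k ` {1..k}"
      by (intro image_cong) (auto simp: u_def)
    finally have w: "v' (Suc k) - c *s v (Suc k) \<in> span (u k ` {1..k})" .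
    have "v' (Suc k) \<notin> span (v' ` {1..k})"
      using indep[of "Suc k"] Suc.prems by (simp add: atLeastLessThanSuc_atLeastAtMost)
    with c have "c \<noteq> 0"
      unfolding span_eq by auto
    have "flag_coeff {1..r} ?n ((u k)(Suc k := c *s u k (Suc k) + (v' (Suc k) - c *s v (Suc k)))) ls =
        flag_coeff {1..r} ?n (u k) ls"
    proof (rule flag_coeff_add_span[where I = "{1..k}"])
      show "c ^ ?n (Suc k) = 1"
        using power_card_power_minus_one[OF \<open>c \<noteq> 0\<close>, of "s (Suc k)"] by (simp add: q_bracket_def)
      fix b j assume j: "j \<in> {1..k}" and b: "0 < b" "b \<le> ?n (Suc k)"
      \<comment> \<open>Monotonicity of \<open>s\<close> yields b < q^s_(k+1) <= q^s_j, the range in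
        which adding b to q^s_j - 1 carries.\<close>
      have "CARD('a) ^ s (Suc k) \<le> CARD('a) ^ s j"
        using antimono[of j "Suc k"] j Suc.prems by (intro power_increasing) auto
      moreover have "b < CARD('a) ^ s (Suc k)"
        using b by (auto simp: q_bracket_def)
      ultimately show "of_nat (?n j + b choose b) = (0 :: 'a)"
        unfolding q_bracket_def using b(1) by (intro of_nat_choose_carry_eq_0) auto
    qed (use Suc.prems lin w in auto)
    also have "(u k)(Suc k := c *s u k (Suc k) + (v' (Suc k) - c *s v (Suc k))) = u (Suc k)"
      by (auto simp: u_def fun_eq_iff)
    finally show ?case
      using Suc by simp
  qed
  moreover have "flag_coeff {1..r} ?n (u r) ls = flag_coeff {1..r} ?n v' ls"
    by (rule cong) (simp add: u_def)
  ultimately show ?thesis by simp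
qed

section \<open>Correspondence between frames and flags\<close>

lemma length_flag_of [simp]: "length (flag_of vs) = length vs"
  by (simp add: flag_of_def)

lemma nth_flag_of: "i < length vs \<Longrightarrow> flag_of vs ! i = span (set (take (Suc i) vs))"
  by (simp add: flag_of_def)

lemma flag_of_snoc: "flag_of (vs @ [x]) = flag_of vs @ [span (set (vs @ [x]))]"
  by (simp add: flag_of_def)

lemma dim_take_frame:
  assumes "vs \<in> frames r" "k \<le> r"
  shows "dim (set (take k vs)) = k"
proof -
  have "independent (set (take k vs))"
    using assms(1) independent_mono[OF _ set_take_subset] by (auto simp: frames_def)
  then have "dim (set (take k vs)) = card (set (take k vs))"
    by (rule dim_eq_card_independent)
  also have "\<dots> = k"
    using assms by (simp add: frames_def distinct_card)
  finally show ?thesis .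
qed

lemma flag_of_in_complete_flags:
  assumes "vs \<in> frames r"
  shows "flag_of vs \<in> complete_flags r"
proof -
  have len: "length vs = r"
    using assms by (simp add: frames_def)
  have "span (set (take (Suc i) vs)) \<subset> span (set (take (Suc (Suc i)) vs))" if "Suc i < r" for i
  proof
    show "span (set (take (Suc i) vs)) \<subseteq> span (set (take (Suc (Suc i)) vs))"
      by (intro span_mono set_take_subset_set_take) simp
    show "span (set (take (Suc i) vs)) \<noteq> span (set (take (Suc (Suc i)) vs))"
      using dim_take_frame[OF assms, of "Suc i"] dim_take_frame[OF assms, of "Suc (Suc i)"] that
      by (auto dest: span_eq_dim)
  qed
  then show ?thesis
    using assms by (simp add: complete_flags_def len nth_flag_of dim_take_frame)
qed

text \<open>A frame of the first r subspaces is extended by a vector of the last subspace outside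
  their span.\<close>

lemma ex_frame:
  assumes "W \<in> complete_flags r"
  shows "\<exists>vs\<in>frames r. flag_of vs = W"
  using assms
proof (induction r arbitrary: W)
  case 0
  then show ?case
    by (intro bexI[of _ "[]"]) (auto simp: complete_flags_def frames_def flag_of_def independent_empty)
next
  case (Suc r)
  have W: "length W = Suc r" "subspace (W ! r)" "dim (W ! r) = Suc r"
    using Suc.prems by (auto simp: complete_flags_def)
  have "take r W \<in> complete_flags r"
    using Suc.prems by (auto simp: complete_flags_def)
  then obtain vs where vs: "vs \<in> frames r" "flag_of vs = take r W"
    using Suc.IH by blast
  have len: "length vs = r"
    using vs(1) by (simp add: frames_def)
  \<comment> \<open>The zero subspace is not an entry of the list, so r = 0 is a separate
    case.\<close>
  have sub: "span (set vs) \<subseteq> W ! r"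
  proof (cases r)
    case 0
    then show ?thesis
      using len W(2) by (simp add: subspace_0)
  next
    case (Suc k)
    then have "span (set vs) = W ! k"
      using vs(2) len nth_flag_of[of k vs] by simp
    moreover have "W ! k \<subset> W ! r"
      using Suc.prems Suc by (auto simp: complete_flags_def)
    ultimately show ?thesis by blast
  qed
  have dim_vs: "dim (set vs) = r"
    using dim_take_frame[OF vs(1), of r] len by simp
  have "\<not> W ! r \<subseteq> span (set vs)"
    using dim_mono[of "W ! r" "set vs"] W(3) dim_vs by auto
  then obtain x where x: "x \<in> W ! r" "x \<notin> span (set vs)" by blast
  then have "x \<notin> set vs"
    using span_base by blast
  with x vs(1) have frame: "vs @ [x] \<in> frames (Suc r)"
    by (simp add: frames_def independent_insertI)
  have "span (set (vs @ [x])) = W ! r"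
  proof (rule subspace_dim_equal)
    show "span (set (vs @ [x])) \<subseteq> W ! r"
      using sub x(1) W(2) span_superset by (intro span_minimal) auto
    show "dim (W ! r) \<le> dim (span (set (vs @ [x])))"
      unfolding dim_span
      using dim_take_frame[OF frame, of "Suc r"] W(3) len by simp
  qed (simp_all add: W(2))
  then have "flag_of (vs @ [x]) = take r W @ [W ! r]"
    by (simp only: flag_of_snoc vs(2))
  also have "\<dots> = W"
    using W(1) by (metis lessI take_Suc_conv_app_nth take_all order_refl)
  finally show ?case
    using frame by blast
qed

end

section \<open>Coefficients of iterated Frobenius twists\<close>

text \<open>Horner scheme for the product of the f_i^(Q_(i+1) ... Q_k), where f_i is the product
  over \<open>B i\<close>. For Q_i = q^(s_i - s_(i+1)), k = r and s_(r+1) = 0 the exponents are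
  q^s_(i+1).\<close>

primrec frobenius_tower :: "(nat \<Rightarrow> nat) \<Rightarrow> (nat \<Rightarrow> 'c list) \<Rightarrow> nat \<Rightarrow> 'c list" where
  "frobenius_tower Q B 0 = []"
| "frobenius_tower Q B (Suc k) = concat (replicate (Q (Suc k)) (frobenius_tower Q B k)) @ B (Suc k)"

lemma prod_list_concat_replicate:
  fixes f :: "'c \<Rightarrow> 'r::comm_monoid_mult"
  shows "(\<Prod>x\<leftarrow>concat (replicate n xs). f x) = (\<Prod>x\<leftarrow>xs. f x) ^ n"
  by (induction n) simp_all

lemma set_frobenius_tower: "set (frobenius_tower Q B k) \<subseteq> (\<Union>i\<in>{1..k}. set (B i))"
  by (induction k) (auto simp: atLeastAtMostSuc_conv)

text \<open>Each stage multiplies a Q-th power by a polynomial of degree (k+1)(Q-1), so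
  \<open>lookup_power_mult\<close> splits off one coefficient at a time.\<close>

lemma lookup_frobenius_tower:
  fixes f :: "'c \<Rightarrow> (nat multiset \<Rightarrow>\<^sub>0 'a::{field,finite})"
  assumes hom: "\<And>l. homogeneous 1 (f l)"
    and Q: "\<And>i. Q i = CARD('a) ^ (s i - s (Suc i))"
    and len: "\<And>i. i \<in> {1..k} \<Longrightarrow> length (B i) = i * (Q i - 1)"
    and s: "\<And>i j. 1 \<le> j \<Longrightarrow> j \<le> i \<Longrightarrow> i \<le> Suc k \<Longrightarrow> s i \<le> s j"
  shows "lookup (\<Prod>l\<leftarrow>frobenius_tower Q B k. f l) (\<Sum>j\<in>{1..k}. replicate_mset (CARD('a) ^ (s j - s (Suc k)) - 1) j) =
    (\<Prod>i\<in>{1..k}. lookup (\<Prod>l\<leftarrow>B i. f l) (\<Sum>j\<in>{1..i}. replicate_mset (Q i - 1) j))"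
  using len s
proof (induction k)
  case (Suc k)
  let ?q = "CARD('a)" and ?Q = "Q (Suc k)"
  let ?M = "\<Sum>j\<in>{1..k}. replicate_mset (?q ^ (s j - s (Suc k)) - 1) j"
  let ?R = "\<Sum>j\<in>{1..Suc k}. replicate_mset (?Q - 1) j"
  have mono: "(\<Sum>j\<in>{1..Suc k}. replicate_mset (?q ^ (s j - s (Suc (Suc k))) - 1) j) = repeat_mset ?Q ?M + ?R"
  proof (rule multiset_eqI)
    fix j
    \<comment> \<open>The expansion q^(a+b) - 1 = q^b (q^a - 1) + (q^b - 1) separates the multiple
      of Q from the remainder Q - 1.\<close>
    have *: "?q ^ (s j - s (Suc (Suc k))) - 1 = ?Q * (?q ^ (s j - s (Suc k)) - 1) + (?Q - 1)" if "j \<in> {1..k}"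
    proof -
      have "s j - s (Suc (Suc k)) = (s j - s (Suc k)) + (s (Suc k) - s (Suc (Suc k)))"
        using Suc.prems(2)[of j "Suc k"] Suc.prems(2)[of "Suc k" "Suc (Suc k)"] that by auto
      then have "?q ^ (s j - s (Suc (Suc k))) = ?Q * ?q ^ (s j - s (Suc k))"
        by (simp only: power_add Q mult.commute)
      moreover have "?q ^ (s j - s (Suc k)) \<ge> 1" "?Q \<ge> 1"
        by (simp_all add: Q Suc_leI)
      ultimately show ?thesis
        by (simp add: diff_mult_distrib2)
    qed
    show "count (\<Sum>j\<in>{1..Suc k}. replicate_mset (?q ^ (s j - s (Suc (Suc k))) - 1) j) j = count (repeat_mset ?Q ?M + ?R) j"
    proof (cases "j \<in> {1..k}")
      case True
      then show ?thesis
        using * by (simp add: count_sum del: One_nat_def)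
    next
      case False
      then show ?thesis
        by (cases "j = Suc k") (auto simp: count_sum Q)
    qed
  qed
  have "homogeneous (length (B (Suc k))) (\<Prod>l\<leftarrow>B (Suc k). f l)"
    using hom by (intro homogeneous_prod_list)
  then have "homogeneous (card {1..Suc k} * (?Q - 1)) (\<Prod>l\<leftarrow>B (Suc k). f l)"
    using Suc.prems(1)[of "Suc k"] by simp
  then have "lookup ((\<Prod>l\<leftarrow>frobenius_tower Q B k. f l) ^ ?Q * (\<Prod>l\<leftarrow>B (Suc k). f l)) (repeat_mset ?Q ?M + ?R) =
      lookup (\<Prod>l\<leftarrow>frobenius_tower Q B k. f l) ?M * lookup (\<Prod>l\<leftarrow>B (Suc k). f l) ?R"
    by (rule lookup_power_mult[OF finite_atLeastAtMost Q _ refl])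
  moreover have "lookup (\<Prod>l\<leftarrow>frobenius_tower Q B k. f l) ?M =
      (\<Prod>i\<in>{1..k}. lookup (\<Prod>l\<leftarrow>B i. f l) (\<Sum>j\<in>{1..i}. replicate_mset (Q i - 1) j))"
    using Suc.prems by (intro Suc.IH) auto
  moreover have "(\<Prod>l\<leftarrow>frobenius_tower Q B (Suc k). f l) = (\<Prod>l\<leftarrow>frobenius_tower Q B k. f l) ^ ?Q * (\<Prod>l\<leftarrow>B (Suc k). f l)"
    by (simp add: prod_list_concat_replicate)
  moreover have "(\<Prod>i\<in>{1..Suc k}. g i) = (\<Prod>i\<in>{1..k}. g i) * g (Suc k)" for g :: "nat \<Rightarrow> 'a"
    by (simp add: atLeastAtMostSuc_conv mult.commute)
  ultimately show ?case
    unfolding mono by (simp only:)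
qed simp

text \<open>Setting the variables outside \<open>A\<close> to \<open>0\<close> turns the polynomial \<open>p\<close> into the monomial \<open>m\<close>.\<close>

definition restricts_to :: "'i set \<Rightarrow> 'i multiset \<Rightarrow> ('i multiset \<Rightarrow>\<^sub>0 'a::comm_semiring_1) \<Rightarrow> bool" where
  "restricts_to A m p \<longleftrightarrow> set_mset m \<subseteq> A \<and>
    (\<forall>k. set_mset k \<subseteq> A \<longrightarrow> lookup p k = (if k = m then 1 else 0))"

text \<open>Setting variables to 0 is multiplicative: a monomial in the variables of
  \<open>A\<close> only arises from factors in those variables.\<close>

lemma restricts_to_mult:
  assumes "restricts_to A m p" "restricts_to A n q"
  shows "restricts_to A (m + n) (p * q)"
  unfolding restricts_to_def
proof (intro conjI allI impI)
  show "set_mset (m + n) \<subseteq> A"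
    using assms by (simp add: restricts_to_def)
  fix k assume k: "set_mset k \<subseteq> A"
  have "m \<in> keys p"
    using assms(1) by (simp add: restricts_to_def in_keys_iff)
  have "lookup (p * q) k = lookup (\<Sum>a\<in>keys p. single a (lookup p a) * q) k"
    by (simp add: sum_single_lookup flip: sum_distrib_right)
  also have "\<dots> = (\<Sum>a\<in>keys p. if a = m then lookup (single m 1 * q) k else 0)"
    unfolding lookup_sum
  proof (intro sum.cong refl)
    fix a assume "a \<in> keys p"
    show "lookup (single a (lookup p a) * q) k = (if a = m then lookup (single m 1 * q) k else 0)"
    proof (cases "a \<subseteq># k")
      case True
      then have "set_mset a \<subseteq> A"
        using k set_mset_mono by blast
      then show ?thesis
        using assms(1) by (auto simp: restricts_to_def lookup_single_mult)
    qed (auto simp: lookup_single_mult)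
  qed
  also have "\<dots> = lookup (single m 1 * q) k"
    using \<open>m \<in> keys p\<close> by simp
  also have "\<dots> = (if k = m + n then 1 else 0)"
  proof (cases "m \<subseteq># k")
    case True
    moreover have "set_mset (k - m) \<subseteq> A"
      using k by (meson in_diffD subset_iff)
    moreover have "k - m = n \<longleftrightarrow> k = m + n"
      using True by auto
    ultimately show ?thesis
      using assms(2) by (simp add: restricts_to_def lookup_single_mult)
  next
    case False
    then show ?thesis
      by (auto simp: lookup_single_mult)
  qed
  finally show "lookup (p * q) k = (if k = m + n then 1 else 0)" .
qed

lemma restricts_to_1: "restricts_to A {#} 1"
  by (simp add: restricts_to_def lookup_one when_def)

lemma restricts_to_prod_list:
  assumes "\<And>l. l \<in> set ls \<Longrightarrow> restricts_to A {#i#} (f l)"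
  shows "restricts_to A (replicate_mset (length ls) i) (\<Prod>l\<leftarrow>ls. f l)"
  using assms
proof (induction ls)
  case (Cons l ls)
  then have "restricts_to A ({#i#} + replicate_mset (length ls) i) (f l * (\<Prod>l\<leftarrow>ls. f l))"
    by (intro restricts_to_mult) auto
  then show ?case by simp
qed (simp add: restricts_to_1)

lemma restricts_to_prod_list_concat:
  assumes "\<And>j. j \<in> set js \<Longrightarrow> restricts_to A (m j) (\<Prod>l\<leftarrow>g j. f l)" and "distinct js"
  shows "restricts_to A (\<Sum>j\<in>set js. m j) (\<Prod>l\<leftarrow>concat (map g js). f l)"
  using assms
proof (induction js)
  case (Cons j js)
  then have "restricts_to A (m j + (\<Sum>j\<in>set js. m j)) ((\<Prod>l\<leftarrow>g j. f l) * (\<Prod>l\<leftarrow>concat (map g js). f l))"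
    by (intro restricts_to_mult) auto
  then show ?case
    using Cons.prems(2) by simp
qed (simp add: restricts_to_1)

lemma restricts_to_generic_value:
  assumes "finite J" "A \<subseteq> J" "j \<in> A" and l: "\<And>b. b \<in> A \<Longrightarrow> l (v b) = (if b = j then 1 else 0)"
  shows "restricts_to A {#j#} (generic_value J v l)"
  unfolding restricts_to_def
proof (intro conjI allI impI)
  fix k assume k: "set_mset k \<subseteq> A"
  have "lookup (generic_value J v l) k = (\<Sum>b\<in>J. if b = j then (if k = {#j#} then 1 else 0) else 0)"
    unfolding generic_value_def lookup_sum
  proof (intro sum.cong refl)
    fix b
    show "lookup (single {#b#} (l (v b))) k = (if b = j then (if k = {#j#} then 1 else 0) else 0)"
      using k l[of b] \<open>j \<in> A\<close> by (auto simp: lookup_single when_def)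
  qed
  then show "lookup (generic_value J v l) k = (if k = {#j#} then 1 else 0)"
    using assms by auto
qed (use \<open>j \<in> A\<close> in simp)

section \<open>Linear forms that separate flags\<close>

lemma in_set_concat_map: "y \<in> set (concat (map f xs)) \<longleftrightarrow> (\<exists>x\<in>set xs. y \<in> set (f x))"
  by auto

text \<open>The linear factors of f_i, with m for m_i; \<open>cs\<close> will list the nonzero
  scalars. The multiplicity of \<open>x i\<close> is what brings the number of factors to i * m,
  provided that the subtraction does not truncate.\<close>

definition separating_block :: "'a::comm_ring_1 list \<Rightarrow> nat \<Rightarrow> nat \<Rightarrow> (nat \<Rightarrow> 'b \<Rightarrow> 'a) \<Rightarrow> nat \<Rightarrow> ('b \<Rightarrow> 'a) list" where
  "separating_block cs d m x i =
    concat (map (\<lambda>j. replicate m (x j)) [1..<i]) @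
    replicate (m - length cs * (d - i)) (x i) @
    concat (map (\<lambda>a. map (\<lambda>c v. x i v - c * x a v) cs) [Suc i..<Suc d])"

lemma length_separating_block:
  assumes "length cs * (d - i) \<le> m" "1 \<le> i" "i \<le> d"
  shows "length (separating_block cs d m x i) = i * m"
proof -
  have "length (separating_block cs d m x i) = (i - 1) * m + (m - length cs * (d - i)) + length cs * (d - i)"
    by (simp add: separating_block_def length_concat o_def sum_list_triv mult.commute del: upt_Suc)
  also have "\<dots> = i * m"
    using assms by (cases i) auto
  finally show ?thesis .
qed

text \<open>With the variables beyond i set to 0, x_j becomes t_j for j <= i, and x_i - c x_a
  becomes t_i because a > i. The whole product becomes the required monomial.\<close>

lemma lookup_separating_block_dual:
  fixes x :: "nat \<Rightarrow> 'b \<Rightarrow> 'a::comm_ring_1"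
  assumes "length cs * (d - i) \<le> m" "i \<in> {1..r}" "i \<le> d"
    and x: "\<And>a b. a \<in> {1..d} \<Longrightarrow> b \<in> {1..r} \<Longrightarrow> x a (v b) = (if a = b then 1 else 0)"
  shows "lookup (\<Prod>l\<leftarrow>separating_block cs d m x i. generic_value {1..r} v l) (\<Sum>j\<in>{1..i}. replicate_mset m j) = 1"
proof -
  let ?f = "generic_value {1..r} v"
  let ?l1 = "concat (map (\<lambda>j. replicate m (x j)) [1..<i])"
    and ?l2 = "replicate (m - length cs * (d - i)) (x i)"
    and ?l3 = "concat (map (\<lambda>a. map (\<lambda>c v. x i v - c * x a v) cs) [Suc i..<Suc d])"
  have xj: "restricts_to {1..i} {#j#} (?f (x j))" if "j \<in> {1..i}" for j
    by (rule restricts_to_generic_value) (use assms that in auto)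
  have "restricts_to {1..i} (replicate_mset m j) (\<Prod>l\<leftarrow>replicate m (x j). ?f l)" if "j \<in> {1..i}" for j
    using restricts_to_prod_list[of "replicate m (x j)" "{1..i}" j ?f] xj[OF that] by simp
  then have 1: "restricts_to {1..i} (\<Sum>j\<in>set [1..<i]. replicate_mset m j) (\<Prod>l\<leftarrow>?l1. ?f l)"
    by (intro restricts_to_prod_list_concat) auto
  have 2: "restricts_to {1..i} (replicate_mset (length ?l2) i) (\<Prod>l\<leftarrow>?l2. ?f l)"
    using xj[of i] assms(2) by (intro restricts_to_prod_list) auto
  have 3: "restricts_to {1..i} (replicate_mset (length ?l3) i) (\<Prod>l\<leftarrow>?l3. ?f l)"
  proof (rule restricts_to_prod_list)
    fix l assume "l \<in> set ?l3"
    then obtain a where "a \<in> set [Suc i..<Suc d]" and "l \<in> set (map (\<lambda>c v. x i v - c * x a v) cs)"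
      unfolding in_set_concat_map by (rule bexE)
    moreover from this(2) obtain c where l: "l = (\<lambda>v. x i v - c * x a v)"
      unfolding set_map by (rule imageE)
    ultimately have "a \<in> {i<..d}" by auto
    then show "restricts_to {1..i} {#i#} (?f l)"
      unfolding l using assms by (intro restricts_to_generic_value) auto
  qed
  have len: "length ?l3 = length cs * (d - i)"
    by (simp add: length_concat o_def sum_list_triv mult.commute del: upt_Suc)
  have "{1..i} = insert i {1..<i}"
    using assms(2) by auto
  then have "(\<Sum>j\<in>{1..i}. replicate_mset m j) = replicate_mset m i + (\<Sum>j\<in>set [1..<i]. replicate_mset m j)"
    by simp
  also have "replicate_mset m i = replicate_mset (length ?l2) i + replicate_mset (length ?l3) i"
    using assms(1) len by (simp flip: replicate_mset_add)
  finally have eq: "(\<Sum>j\<in>{1..i}. replicate_mset m j) =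
      (\<Sum>j\<in>set [1..<i]. replicate_mset m j) + (replicate_mset (length ?l2) i + replicate_mset (length ?l3) i)"
    by (simp only: ac_simps)
  have "restricts_to {1..i} (\<Sum>j\<in>{1..i}. replicate_mset m j) ((\<Prod>l\<leftarrow>?l1. ?f l) * ((\<Prod>l\<leftarrow>?l2. ?f l) * (\<Prod>l\<leftarrow>?l3. ?f l)))"
    unfolding eq by (intro restricts_to_mult 1 2 3)
  then show ?thesis
    by (simp add: separating_block_def restricts_to_def)
qed

text \<open>One of the factors only involves the variables beyond \<open>i\<close>.\<close>

lemma lookup_separating_block_eq_0:
  fixes x :: "nat \<Rightarrow> 'b \<Rightarrow> 'a::field"
  assumes "length cs * (d - i) < m" "set cs = UNIV - {0}"
    and x: "\<And>a b. a \<in> {i..d} \<Longrightarrow> b \<in> {1..<i} \<Longrightarrow> x a (v b) = 0"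
    and a: "a \<in> {i<..d}" "x a (v i) \<noteq> 0"
  shows "lookup (\<Prod>l\<leftarrow>separating_block cs d m x i. generic_value {1..r} v l) (\<Sum>j\<in>{1..i}. replicate_mset m j) = 0"
proof -
  let ?f = "generic_value {1..r} v"
  have "\<exists>l\<in>set (separating_block cs d m x i). \<forall>b\<in>{1..i}. l (v b) = 0"
  proof (cases "x i (v i) = 0")
    case True
    then have "\<forall>b\<in>{1..i}. x i (v b) = 0"
      using x[of i] a by (auto simp: le_less)
    \<comment> \<open>The strict inequality in the hypothesis makes the multiplicity of
      \<open>x i\<close> positive.\<close>
    moreover have "x i \<in> set (separating_block cs d m x i)"
      using assms(1) by (simp add: separating_block_def)
    ultimately show ?thesis by blast
  next
    case False
    \<comment> \<open>The scalar for which x_i - c x_a kills v_i; it is nonzero, hence in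
      \<open>cs\<close>.\<close>
    define c where "c = x i (v i) / x a (v i)"
    have "c \<in> set cs"
      using False a(2) assms(2) by (simp add: c_def)
    then have "(\<lambda>v. x i v - c * x a v) \<in> set (map (\<lambda>c v. x i v - c * x a v) cs)"
      unfolding set_map by (rule imageI)
    moreover have "a \<in> set [Suc i..<Suc d]"
      using a(1) by auto
    ultimately have "(\<lambda>v. x i v - c * x a v) \<in> set (separating_block cs d m x i)"
      unfolding separating_block_def set_append by (intro UnI2 in_set_concat_map[THEN iffD2] bexI[of _ a])
    moreover have "\<forall>b\<in>{1..i}. x i (v b) - c * x a (v b) = 0"
      using x[of i] x[of a] a by (auto simp: le_less c_def)
    ultimately show ?thesis
      by (intro bexI[of _ "\<lambda>v. x i v - c * x a v"])
  qed
  then obtain l us ws where l: "separating_block cs d m x i = us @ l # ws" "\<forall>b\<in>{1..i}. l (v b) = 0"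
    by (meson split_list)
  \<comment> \<open>Every monomial of this factor has a variable beyond i, but the monomial in
    question has none.\<close>
  have "\<not> set_mset m \<subseteq> {1..i}" if "m \<in> keys (?f l)" for m
  proof -
    have "keys (?f l) \<subseteq> (\<Union>b\<in>{1..r}. keys (single {#b#} (l (v b))))"
      unfolding generic_value_def by (rule keys_sum)
    from subsetD[OF this that] obtain b where b: "b \<in> {1..r}" "m \<in> keys (single {#b#} (l (v b)))"
      by (rule UN_E)
    then have "m = {#b#}" "l (v b) \<noteq> 0"
      by (auto split: if_splits)
    with l(2) show ?thesis by auto
  qed
  moreover have "set_mset (\<Sum>j\<in>{1..i}. replicate_mset m j) \<subseteq> {1..i}"
    by (auto simp: set_mset_sum split: if_splits)
  ultimately have "(\<Sum>j\<in>{1..i}. replicate_mset m j) \<noteq> a + b" if "a \<in> keys (?f l)" for a b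
    using that by (metis Un_upper1 order_trans set_mset_union)
  then have "(\<Sum>j\<in>{1..i}. replicate_mset m j) \<notin> keys (?f l * (\<Prod>l\<leftarrow>us @ ws. ?f l))"
    using keys_mult[of "?f l" "\<Prod>l\<leftarrow>us @ ws. ?f l"] by blast
  moreover have prod_eq: "(\<Prod>l\<leftarrow>us @ l # ws. ?f l) = ?f l * (\<Prod>l\<leftarrow>us @ ws. ?f l)"
    by (simp add: mult.left_commute)
  ultimately show ?thesis
    unfolding l(1) prod_eq by (simp only: in_keys_iff not_not)
qed

lemma length_q_brackets: "length (q_brackets q r s) = r"
  by (simp add: q_brackets_def del: upt_Suc)

section \<open>Adapted bases and functionals dual to flags\<close>

context finite_field_vector_space
begin

lemma linear_form_vanishes_on_span:
  assumes "linear_form l" "\<And>w. w \<in> S \<Longrightarrow> l w = 0" "v \<in> span S"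
  shows "l v = 0"
  using assms(3)
proof (induction rule: span_induct_alt)
  case base
  show ?case
    using linear_form_scale[OF assms(1), of 0 0] by simp
next
  case (step c x y)
  then show ?case
    by (simp add: linear_form_add[OF assms(1)] linear_form_scale[OF assms(1)] assms(2))
qed

lemma ex_frame_extension:
  assumes "vs \<in> frames r"
  shows "\<exists>es. take r es = vs \<and> distinct es \<and> independent (set es) \<and> span (set es) = UNIV \<and>
    length es = dim UNIV"
proof -
  have vs: "length vs = r" "distinct vs" "independent (set vs)"
    using assms by (auto simp: frames_def)
  let ?B = "extend_basis (set vs)"
  have B: "set vs \<subseteq> ?B" "independent ?B" "span ?B = UNIV"
    using vs(3) by (simp_all add: extend_basis_superset independent_extend_basis)
  then have "finite ?B"
    using finiteI_independent by blast
  then obtain ws where ws: "set ws = ?B - set vs" "distinct ws"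
    using finite_distinct_list[of "?B - set vs"] by auto
  have "set (vs @ ws) = ?B"
    using B(1) ws(1) by auto
  moreover from this have "length (vs @ ws) = dim UNIV"
    using vs(2) ws B(2,3) distinct_card[of "vs @ ws"] dim_span_eq_card_independent[of ?B] by auto
  ultimately show ?thesis
    using vs ws B by (intro exI[of _ "vs @ ws"]) auto
qed

text \<open>Frames are lists indexed from 0, while \<open>s\<close> and the variables t_j are
  indexed from 1; hence the shift by 1 from here on.\<close>

lemma set_take_eq_image: "k \<le> length vs \<Longrightarrow> set (take k vs) = (\<lambda>i. vs ! (i - 1)) ` {1..k}"
proof -
  assume "k \<le> length vs"
  then have "set (take k vs) = (!) vs ` {0..<k}"
    by (simp add: nth_image)
  also have "\<dots> = (\<lambda>i. vs ! (i - 1)) ` Suc ` {0..<k}"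
    by (simp only: image_image diff_Suc_1)
  also have "Suc ` {0..<k} = {1..k}"
    by (simp add: atLeastLessThanSuc_atLeastAtMost)
  finally show ?thesis .
qed

lemma flag_of_eq_iff:
  assumes "length vs = r" "length vs' = r"
  shows "flag_of vs = flag_of vs' \<longleftrightarrow>
    (\<forall>k\<le>r. span ((\<lambda>i. vs ! (i - 1)) ` {1..k}) = span ((\<lambda>i. vs' ! (i - 1)) ` {1..k}))"
proof -
  have "flag_of vs = flag_of vs' \<longleftrightarrow> (\<forall>k<r. span (set (take (Suc k) vs)) = span (set (take (Suc k) vs')))"
    using assms by (auto simp: list_eq_iff_nth_eq nth_flag_of)
  \<comment> \<open>The index k = 0 may be included because both spans are then zero.\<close>
  also have "\<dots> \<longleftrightarrow> (\<forall>k\<le>r. span (set (take k vs)) = span (set (take k vs')))"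
    by (metis Suc_le_eq not0_implies_Suc take0)
  also have "\<dots> \<longleftrightarrow> (\<forall>k\<le>r. span ((\<lambda>i. vs ! (i - 1)) ` {1..k}) = span ((\<lambda>i. vs' ! (i - 1)) ` {1..k}))"
    using assms by (simp add: set_take_eq_image)
  finally show ?thesis .
qed

lemma frame_length_le_dim: "vs \<in> frames r \<Longrightarrow> r \<le> dim UNIV"
  using dim_take_frame[of vs r r] dim_subset[of "set (take r vs)" UNIV] by simp

lemma frame_notin_span:
  assumes "vs \<in> frames r" "k \<in> {1..r}"
  shows "vs ! (k - 1) \<notin> span ((\<lambda>i. vs ! (i - 1)) ` {1..<k})"
proof
  assume in_span: "vs ! (k - 1) \<in> span ((\<lambda>i. vs ! (i - 1)) ` {1..<k})"
  have len: "length vs = r" "distinct vs"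
    using assms(1) by (auto simp: frames_def)
  have "(\<lambda>i. vs ! (i - 1)) ` {1..<k} = set (take (k - 1) vs)"
    using set_take_eq_image[of "k - 1" vs] assms(2) len by (cases k) (simp_all add: atLeastLessThanSuc_atLeastAtMost)
  moreover have "set (take k vs) = insert (vs ! (k - 1)) (set (take (k - 1) vs))"
    using assms(2) len take_Suc_conv_app_nth[of "k - 1" vs] by (cases k) auto
  ultimately have "span (set (take k vs)) = span (set (take (k - 1) vs))"
    using in_span by (simp add: span_redundant)
  then show False
    using dim_take_frame[OF assms(1), of k] dim_take_frame[OF assms(1), of "k - 1"] assms(2)
    by (auto dest: span_eq_dim)
qed

lemma map_nth_shifted:
  "length vs = r \<Longrightarrow> map (\<lambda>i. vs ! (i - 1)) [1..<Suc r] = vs"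
  by (intro nth_equalityI) (simp_all del: upt_Suc)

lemma form_power_product_frame:
  assumes "length vs = r"
  shows "form ls (power_product (q_brackets CARD('a) r s) vs) =
    flag_coeff {1..r} (\<lambda>i. q_bracket CARD('a) (s i)) (\<lambda>i. vs ! (i - 1)) ls"
  using form_power_product[of "[1..<Suc r]" ls "\<lambda>i. q_bracket CARD('a) (s i)" "\<lambda>i. vs ! (i - 1)"]
  unfolding map_nth_shifted[OF assms]
  by (simp add: q_brackets_def atLeastLessThanSuc_atLeastAtMost del: upt_Suc)

text \<open>Such a functional reads off the coefficient of the flag of \<open>e\<close>, which
  yields injectivity. The forms are the Frobenius tower over the separating blocks of coordinates
  adapted to \<open>e\<close>.\<close>

lemma ex_separating_forms:
  assumes e: "e \<in> frames r"
    and s0: "s (Suc r) = 0"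
    and s: "\<And>i j. 1 \<le> j \<Longrightarrow> j \<le> i \<Longrightarrow> i \<le> Suc r \<Longrightarrow> s i \<le> s j"
    and bound: "\<And>i. i \<in> {1..r} \<Longrightarrow> (CARD('a) - 1) * (dim UNIV - i + 1) \<le> CARD('a) ^ (s i - s (Suc i)) - 1"
  shows "\<exists>ls. (\<forall>l\<in>set ls. linear_form l) \<and>
    form ls (power_product (q_brackets CARD('a) r s) e) = 1 \<and>
    (\<forall>vs\<in>frames r. flag_of vs \<noteq> flag_of e \<longrightarrow> form ls (power_product (q_brackets CARD('a) r s) vs) = 0)"
proof -
  define d where "d = dim (UNIV :: 'b set)"
  obtain es where es: "take r es = e" "distinct es" "independent (set es)" "span (set es) = UNIV" "length es = d"
    using ex_frame_extension[OF e] by (auto simp: d_def)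
  have len_e: "length e = r"
    using e by (simp add: frames_def)
  then have "r \<le> d"
    using es by (metis length_take min.absorb_iff2 nat_le_linear min.absorb_iff1)
  obtain cs :: "'a list" where cs: "set cs = UNIV - {0}" "distinct cs"
    using finite_distinct_list[of "UNIV - {0 :: 'a}"] by auto
  have len_cs: "length cs = CARD('a) - 1"
    using cs distinct_card[of cs] by (simp add: card_Diff_singleton)
  have "CARD('a) > 1"
    using card_mono[of "UNIV :: 'a set" "{0, 1}"] by simp
  \<comment> \<open>Coordinates for a basis that extends \<open>e\<close>; the first r of them are
    dual to \<open>e\<close>.\<close>
  define x where "x a v = representation (set es) v (es ! (a - 1))" for a v
  have lin_x: "linear_form (x a)" for a
    using linear_form_representation[OF es(3,4)] by (simp add: x_def[abs_def])
  have x_e: "x a (es ! (b - 1)) = (if a = b then 1 else 0)" if "a \<in> {1..d}" "b \<in> {1..d}" for a b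
    using that es by (auto simp: x_def representation_basis nth_eq_iff_index_eq)
  define Q where "Q i = CARD('a) ^ (s i - s (Suc i))" for i
  define B where "B i = separating_block cs d (Q i - 1) x i" for i
  define ls where "ls = frobenius_tower Q B r"
  \<comment> \<open>The summand 1 in the bound leaves a surplus of q - 1 > 0, so the inequality is
    strict.\<close>
  have bound': "length cs * (d - i) < Q i - 1" if "i \<in> {1..r}" for i
    using bound[OF that] \<open>CARD('a) > 1\<close> by (simp add: len_cs d_def Q_def algebra_simps)
  have lin: "\<forall>l\<in>set ls. linear_form l"
  proof -
    have "linear_form l" if "l \<in> set (B i)" for l i
      using that unfolding B_def separating_block_def
      by (auto simp: in_set_concat_map lin_x linear_form_add[OF lin_x] linear_form_scale[OF lin_x] algebra_simps
          intro!: linear_formI simp del: set_concat)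
    then show ?thesis
      using set_frobenius_tower[of Q B r] by (auto simp: ls_def)
  qed
  have form_ls: "form ls (power_product (q_brackets CARD('a) r s) vs) =
      (\<Prod>i\<in>{1..r}. lookup (\<Prod>l\<leftarrow>B i. generic_value {1..r} (\<lambda>i. vs ! (i - 1)) l) (\<Sum>j\<in>{1..i}. replicate_mset (Q i - 1) j))"
    if "length vs = r" for vs
  proof -
    have "lookup (\<Prod>l\<leftarrow>frobenius_tower Q B r. generic_value {1..r} (\<lambda>i. vs ! (i - 1)) l)
        (\<Sum>j\<in>{1..r}. replicate_mset (CARD('a) ^ (s j - s (Suc r)) - 1) j) =
      (\<Prod>i\<in>{1..r}. lookup (\<Prod>l\<leftarrow>B i. generic_value {1..r} (\<lambda>i. vs ! (i - 1)) l) (\<Sum>j\<in>{1..i}. replicate_mset (Q i - 1) j))"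
    proof (rule lookup_frobenius_tower)
      show "homogeneous 1 (generic_value {1..r} (\<lambda>i. vs ! (i - 1)) l)" for l :: "'b \<Rightarrow> 'a"
        by (rule homogeneous_generic_value)
    next
      fix i assume "i \<in> {1..r}"
      then show "length (B i) = i * (Q i - 1)"
        unfolding B_def using bound'[of i] \<open>r \<le> d\<close> by (intro length_separating_block) auto
    qed (use s in \<open>auto simp: Q_def\<close>)
    \<comment> \<open>As s_(r+1) = 0, the exponents q^(s_j - s_(r+1)) - 1 are the brackets of the
      s_j.\<close>
    then show ?thesis
      by (simp add: form_power_product_frame[OF that] flag_coeff_def q_bracket_def ls_def s0)
  qed
  have e_nth: "e ! (b - 1) = es ! (b - 1)" if "b \<in> {1..r}" for b
    using es(1) that nth_take[of "b - 1" r es] by auto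
  have "form ls (power_product (q_brackets CARD('a) r s) e) = 1"
    unfolding form_ls[OF len_e]
  proof (intro prod.neutral ballI)
    fix i assume i: "i \<in> {1..r}"
    show "lookup (\<Prod>l\<leftarrow>B i. generic_value {1..r} (\<lambda>i. e ! (i - 1)) l) (\<Sum>j\<in>{1..i}. replicate_mset (Q i - 1) j) = 1"
      unfolding B_def
    proof (rule lookup_separating_block_dual)
      show "length cs * (d - i) \<le> Q i - 1" "i \<le> d"
        using bound'[OF i] i \<open>r \<le> d\<close> by auto
      fix a b assume "a \<in> {1..d}" "b \<in> {1..r}"
      then show "x a (e ! (b - 1)) = (if a = b then 1 else 0)"
        using x_e[of a b] e_nth[of b] \<open>r \<le> d\<close> by auto
    qed (rule i)
  qed
  moreover have "form ls (power_product (q_brackets CARD('a) r s) vs) = 0"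
    if vs: "vs \<in> frames r" and neq: "flag_of vs \<noteq> flag_of e" for vs
  proof -
    have len_vs: "length vs = r"
      using vs by (simp add: frames_def)
    let ?v = "\<lambda>i. vs ! (i - 1)" and ?e = "\<lambda>i. e ! (i - 1)"
    let ?P = "\<lambda>i. i \<le> r \<and> span (?v ` {1..i}) \<noteq> span (?e ` {1..i})"
    \<comment> \<open>The first index at which the flags differ; the block with this index has
      coefficient 0.\<close>
    define i where "i = (LEAST i. ?P i)"
    have "\<exists>i. ?P i"
      using neq flag_of_eq_iff[OF len_vs len_e] by blast
    then have Pi: "?P i"
      unfolding i_def by (rule LeastI_ex)
    have least: "span (?v ` {1..k}) = span (?e ` {1..k})" if "k < i" for k
      using that Pi not_less_Least[of k ?P] unfolding i_def[symmetric] by auto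
    have "i \<noteq> 0"
      using Pi by (metis atLeastatMost_empty_iff2 image_empty not_one_le_zero)
    with Pi have i: "i \<in> {1..r}" by auto
    have x_span: "x a w = 0" if "w \<in> span (?e ` {1..k})" "k < a" "a \<le> d" "k \<le> r" for a k w
    proof (rule linear_form_vanishes_on_span[OF lin_x _ that(1)])
      fix u assume "u \<in> ?e ` {1..k}"
      then obtain b where "b \<in> {1..k}" "u = es ! (b - 1)"
        using e_nth \<open>k \<le> r\<close> by auto
      then show "x a u = 0"
        using x_e[of a b] that \<open>r \<le> d\<close> by auto
    qed
    \<comment> \<open>The earlier v_j lie in this span by minimality of i. If v_i did too, equal
      dimensions would force equal spans.\<close>
    have "?v i \<notin> span (?e ` {1..i})"
    proof
      assume vi: "?v i \<in> span (?e ` {1..i})"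
      have "?v j \<in> span (?e ` {1..i})" if "j \<in> {1..i}" for j
      proof (cases "j = i")
        case False
        then have "?v j \<in> span (?e ` {1..j})"
          using that least[of j] span_base[of "?v j" "?v ` {1..j}"] by auto
        moreover have "span (?e ` {1..j}) \<subseteq> span (?e ` {1..i})"
          using that by (intro span_mono image_mono) auto
        ultimately show ?thesis by blast
      qed (use vi in simp)
      then have "span (?v ` {1..i}) \<subseteq> span (?e ` {1..i})"
        by (intro span_minimal) auto
      moreover have "dim (?v ` {1..i}) = i" "dim (?e ` {1..i}) = i"
        using dim_take_frame[OF vs, of i] dim_take_frame[OF e, of i] i len_vs len_e
        by (simp_all add: set_take_eq_image)
      ultimately have "span (?v ` {1..i}) = span (?e ` {1..i})"
        by (intro subspace_dim_equal) simp_all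
      with Pi show False by blast
    qed
    \<comment> \<open>Otherwise the basis expansion of v_i would involve only the first i vectors of
      \<open>e\<close>.\<close>
    have "\<exists>a\<in>{i<..d}. x a (?v i) \<noteq> 0"
    proof (rule ccontr)
      assume "\<not> ?thesis"
      then have zero: "x a (?v i) = 0" if "a \<in> {i<..d}" for a
        using that by blast
      have "(\<Sum>b\<in>set es. representation (set es) (?v i) b *s b) \<in> span (?e ` {1..i})"
      proof (rule span_sum)
        fix b assume "b \<in> set es"
        then obtain a where a: "a \<in> {1..d}" "b = es ! (a - 1)"
          using es(5) by (metis Suc_le_eq atLeastAtMost_iff diff_Suc_1 in_set_conv_nth le_add1 plus_1_eq_Suc)
        show "representation (set es) (?v i) b *s b \<in> span (?e ` {1..i})"
        proof (cases "a \<le> i")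
          case True
          then have "b \<in> ?e ` {1..i}"
            using a e_nth[of a] i by (intro image_eqI[of _ _ a]) auto
          then show ?thesis
            by (intro span_scale span_base)
        next
          case False
          then show ?thesis
            using zero[of a] a by (simp add: x_def span_zero)
        qed
      qed
      then show False
        using \<open>?v i \<notin> span (?e ` {1..i})\<close> sum_representation_eq[of "set es" "?v i" "set es"] es(3,4) by simp
    qed
    then obtain a where a: "a \<in> {i<..d}" "x a (?v i) \<noteq> 0" by blast
    have "lookup (\<Prod>l\<leftarrow>B i. generic_value {1..r} ?v l) (\<Sum>j\<in>{1..i}. replicate_mset (Q i - 1) j) = 0"
      unfolding B_def
    proof (rule lookup_separating_block_eq_0[where a = a])
      show "length cs * (d - i) < Q i - 1" "set cs = UNIV - {0}" "a \<in> {i<..d}" "x a (?v i) \<noteq> 0"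
        by (fact bound'[OF i] cs(1) a)+
    next
      fix a b assume ab: "a \<in> {i..d}" "b \<in> {1..<i}"
      then have "?v b \<in> span (?e ` {1..b})"
        using least[of b] span_base[of "?v b" "?v ` {1..b}"] by auto
      then show "x a (?v b) = 0"
        using ab i by (intro x_span[of _ b]) auto
    qed
    then show ?thesis
      unfolding form_ls[OF len_vs] using i by (intro prod_zero) auto
  qed
  ultimately show ?thesis
    using lin by blast
qed

section \<open>The morphism\<close>

lemma power_product_flag_eq:
  assumes "vs \<in> frames r" "vs' \<in> frames r" "flag_of vs = flag_of vs'"
    and s: "\<And>i j. 1 \<le> j \<Longrightarrow> j \<le> i \<Longrightarrow> i \<le> r \<Longrightarrow> s i \<le> s j"
  shows "tensor_class (sum_list (q_brackets CARD('a) r s)) (power_product (q_brackets CARD('a) r s) vs) =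
    tensor_class (sum_list (q_brackets CARD('a) r s)) (power_product (q_brackets CARD('a) r s) vs')"
proof -
  have len: "length vs = r" "length vs' = r" "length (q_brackets CARD('a) r s) = r"
    using assms(1,2) by (simp_all add: frames_def q_brackets_def)
  have "form ls (power_product (q_brackets CARD('a) r s) vs) = form ls (power_product (q_brackets CARD('a) r s) vs')"
    if "\<forall>l\<in>set ls. linear_form l" for ls
    unfolding form_power_product_frame[OF len(1)] form_power_product_frame[OF len(2)]
  proof (rule flag_coeff_eq_of_flag_eq[OF frame_notin_span[OF assms(2)] _ _ that])
    show "span ((\<lambda>i. vs ! (i - 1)) ` {1..k}) = span ((\<lambda>i. vs' ! (i - 1)) ` {1..k})" if "k \<le> r" for k
      using that assms(3) flag_of_eq_iff[OF len(1,2)] by blast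
  qed (use s in auto)
  then show ?thesis
    using power_product_in_words[of "q_brackets CARD('a) r s" vs]
      power_product_in_words[of "q_brackets CARD('a) r s" vs'] len
    by (intro tensor_class_eqI) (simp add: tensor_eq_iff)
qed

text \<open>Independence of the frame, from \<open>power_product_flag_eq\<close>, is the uniqueness
  that \<open>THE\<close> requires.\<close>

lemma flag_value_flag_of:
  assumes "vs \<in> frames r"
    and s: "\<And>i j. 1 \<le> j \<Longrightarrow> j \<le> i \<Longrightarrow> i \<le> r \<Longrightarrow> s i \<le> s j"
  shows "flag_value r s (flag_of vs) =
    tensor_class (sum_list (q_brackets CARD('a) r s)) (power_product (q_brackets CARD('a) r s) vs)"
proof -
  have product_class: "pure_power_product (q_brackets CARD('a) r s) ws =
      tensor_class (sum_list (q_brackets CARD('a) r s)) (power_product (q_brackets CARD('a) r s) ws)"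
    if "ws \<in> frames r" for ws
    using that by (intro pure_power_product_class) (simp add: frames_def q_brackets_def)
  show ?thesis
    unfolding flag_value_def
  proof (rule the_equality)
    show "\<exists>ws\<in>frames r. flag_of ws = flag_of vs \<and>
        tensor_class (sum_list (q_brackets CARD('a) r s)) (power_product (q_brackets CARD('a) r s) vs) =
        pure_power_product (q_brackets CARD('a) r s) ws"
      using assms(1) product_class by blast
  next
    fix t assume "\<exists>ws\<in>frames r. flag_of ws = flag_of vs \<and> t = pure_power_product (q_brackets CARD('a) r s) ws"
    then obtain ws where "ws \<in> frames r" "flag_of ws = flag_of vs" "t = pure_power_product (q_brackets CARD('a) r s) ws"
      by blast
    then show "t = tensor_class (sum_list (q_brackets CARD('a) r s)) (power_product (q_brackets CARD('a) r s) vs)"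
      using power_product_flag_eq[OF _ assms(1) _ s] product_class by simp
  qed
qed

text \<open>A representative of \<open>flag_value\<close> built from a chosen frame; on
  representatives the linear extension is simply \<open>free_lift\<close>.\<close>

definition flag_tensor :: "nat \<Rightarrow> (nat \<Rightarrow> nat) \<Rightarrow> 'b set list \<Rightarrow> ('b list \<Rightarrow>\<^sub>0 'a)" where
  "flag_tensor r s W = power_product (q_brackets CARD('a) r s) (SOME vs. vs \<in> frames r \<and> flag_of vs = W)"

lemma flag_tensor_frame:
  assumes "W \<in> complete_flags r"
  obtains vs where "vs \<in> frames r" "flag_of vs = W" "flag_tensor r s W = power_product (q_brackets CARD('a) r s) vs"
proof -
  have "\<exists>vs. vs \<in> frames r \<and> flag_of vs = W"
    using ex_frame[OF assms] by blast
  from someI_ex[OF this] show thesis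
    by (intro that[OF _ _ flag_tensor_def]) simp_all
qed

lemma flag_tensor_in_words:
  "W \<in> complete_flags r \<Longrightarrow> flag_tensor r s W \<in> words (sum_list (q_brackets CARD('a) r s))"
  by (erule flag_tensor_frame[where s = s])
    (simp add: power_product_in_words frames_def q_brackets_def del: upt_Suc)

lemma phi_eq:
  assumes x: "x \<in> flag_space r"
    and s: "\<And>i j. 1 \<le> j \<Longrightarrow> j \<le> i \<Longrightarrow> i \<le> r \<Longrightarrow> s i \<le> s j"
  shows "phi r s x = tensor_class (sum_list (q_brackets CARD('a) r s)) (free_lift (flag_tensor r s) x)"
  unfolding phi_def
proof (rule tensor_lift_class)
  fix W assume "W \<in> keys x"
  then have W: "W \<in> complete_flags r"
    using x by (auto simp: flag_space_def free_on_def)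
  then show "flag_tensor r s W \<in> words (sum_list (q_brackets CARD('a) r s))"
    by (rule flag_tensor_in_words)
  show "flag_value r s W = tensor_class (sum_list (q_brackets CARD('a) r s)) (flag_tensor r s W)"
    using W by (rule flag_tensor_frame[where s = s]) (use flag_value_flag_of[OF _ s] in auto)
qed

end

theorem theorem1:
  fixes scale :: "'a::{field,finite} \<Rightarrow> 'b::ab_group_add \<Rightarrow> 'b"
    and Basis :: "'b set" and r :: nat and s :: "nat \<Rightarrow> nat" and N :: nat
  assumes "finite_dimensional_vector_space scale Basis"
    and "r \<ge> 1"
    and "s (Suc r) = 0"
    and "\<And>i. i \<in> {1..r} \<Longrightarrow> s (Suc i) < s i"
    and "\<And>i. i \<in> {1..r} \<Longrightarrow>
           int (q_bracket CARD('a) (s i - s (Suc i)))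
             \<ge> (int CARD('a) - 1) * (int (vector_space.dim scale UNIV) - int i + 1)"
  defines "N \<equiv> \<Sum>i=1..r. q_bracket CARD('a) (s i)"
  shows "(\<forall>x\<in>vector_space.flag_space scale r.
            vector_space.phi scale r s x \<in> vector_space.divided_power scale N) \<and>
         (\<forall>x\<in>vector_space.flag_space scale r. \<forall>y\<in>vector_space.flag_space scale r.
            vector_space.phi scale r s (x + y) =
              vector_space.tensor_add scale N
                (vector_space.phi scale r s x) (vector_space.phi scale r s y)) \<and>
         (\<forall>c. \<forall>x\<in>vector_space.flag_space scale r.
            vector_space.phi scale r s (free_scale c x) =
              vector_space.tensor_scale scale N c (vector_space.phi scale r s x)) \<and>
         (\<forall>vs\<in>vector_space.frames scale r.
            vector_space.phi scale r s (Poly_Mapping.single (vector_space.flag_of scale vs) 1) =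
              vector_space.pure_power_product scale
                (q_brackets CARD('a) r s) vs) \<and>
         inj_on (vector_space.phi scale r s) (vector_space.flag_space scale r)"
proof -
  interpret finite_field_vector_space scale Basis
    using assms(1) by (simp add: finite_field_vector_space_def)
  let ?ns = "q_brackets CARD('a) r s" and ?\<rho> = "flag_tensor r s"
  have s: "s i \<le> s j" if "1 \<le> j" "j \<le> i" "i \<le> Suc r" for i j
    using that(2,1,3)
  proof (induction i rule: dec_induct)
    case (step k)
    then show ?case
      using assms(4)[of k] by simp
  qed simp
  then have s': "s i \<le> s j" if "1 \<le> j" "j \<le> i" "i \<le> r" for i j
    using that by simp
  have N: "sum_list ?ns = N"
    by (simp add: N_def q_brackets_def interv_sum_list_conv_sum_set_nat atLeastLessThanSuc_atLeastAtMost
        del: upt_Suc)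
  have flags: "W \<in> complete_flags r" if "x \<in> flag_space r" "W \<in> keys x" for x W
    using that by (auto simp: flag_space_def free_on_def)
  have words: "?\<rho> W \<in> words N" if "W \<in> complete_flags r" for W
    using flag_tensor_in_words[OF that, of s] by (simp add: N)
  have lift_words: "free_lift ?\<rho> x \<in> words N" if "x \<in> flag_space r" for x
    using flags[OF that] by (intro free_lift_in_words words)
  have phi: "phi r s x = tensor_class N (free_lift ?\<rho> x)" if "x \<in> flag_space r" for x
    using phi_eq[OF that s'] by (simp add: N)
  have add_closed: "x + y \<in> flag_space r" if "x \<in> flag_space r" "y \<in> flag_space r" for x y
    using that free.subspace_add[OF subspace_free_on] by (simp add: flag_space_def)
  have scale_closed: "free_scale c x \<in> flag_space r" if "x \<in> flag_space r" for c x
    using that free.subspace_scale[OF subspace_free_on] by (simp add: flag_space_def)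
  have "phi r s x \<in> divided_power N" if x: "x \<in> flag_space r" for x
    unfolding phi[OF x]
  proof (rule divided_power_lift)
    fix W assume "W \<in> keys x"
    then have W: "W \<in> complete_flags r"
      using flags[OF x] by blast
    then show "?\<rho> W \<in> words N"
      by (rule words)
    obtain vs where vs: "vs \<in> frames r" "?\<rho> W = power_product ?ns vs"
      using flag_tensor_frame[OF W, of s] by blast
    then have vs_map: "map (\<lambda>i. vs ! (i - 1)) [1..<Suc r] = vs"
      by (intro map_nth_shifted) (simp add: frames_def)
    from power_product_class_in_divided_power[OF distinct_upt, of "\<lambda>i. q_bracket CARD('a) (s i)" 1 "Suc r" "\<lambda>i. vs ! (i - 1)"]
    show "tensor_class N (?\<rho> W) \<in> divided_power N"
      unfolding vs_map vs(2) N [symmetric] q_brackets_def .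
  qed
  moreover have "phi r s (x + y) = tensor_add N (phi r s x) (phi r s y)"
    if "x \<in> flag_space r" "y \<in> flag_space r" for x y
    using that by (simp add: phi add_closed tensor_add_class lift_words free_lift_add)
  moreover have "phi r s (free_scale c x) = tensor_scale N c (phi r s x)" if "x \<in> flag_space r" for c x
    using that by (simp add: phi scale_closed tensor_scale_class lift_words free_lift_scale)
  moreover have "phi r s (single (flag_of vs) 1) = pure_power_product ?ns vs" if vs: "vs \<in> frames r" for vs
  proof -
    have W: "flag_of vs \<in> complete_flags r"
      using vs by (rule flag_of_in_complete_flags)
    then have "single (flag_of vs) 1 \<in> flag_space r"
      by (simp add: flag_space_def free_on_def)
    then have "phi r s (single (flag_of vs) 1) = tensor_class N (?\<rho> (flag_of vs))"
      by (simp add: phi free_lift_single)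
    also obtain ws where ws: "ws \<in> frames r" "flag_of ws = flag_of vs" "?\<rho> (flag_of vs) = power_product ?ns ws"
      using W by (rule flag_tensor_frame)
    then have "tensor_class N (?\<rho> (flag_of vs)) = tensor_class N (power_product ?ns vs)"
      using power_product_flag_eq[where s = s, OF ws(1) vs ws(2) s'] by (simp add: N)
    also have "\<dots> = pure_power_product ?ns vs"
      using pure_power_product_class[of ?ns vs] vs by (simp add: N frames_def length_q_brackets)
    finally show ?thesis .
  qed
  moreover have "inj_on (phi r s) (flag_space r)"
  proof (rule inj_onI, rule poly_mapping_eqI)
    fix x y W assume x: "x \<in> flag_space r" and y: "y \<in> flag_space r" and eq: "phi r s x = phi r s y"
    have "lookup x W = lookup y W" if W: "W \<in> complete_flags r"
    proof -
      obtain e where e: "e \<in> frames r" "flag_of e = W" "?\<rho> W = power_product ?ns e"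
        using W by (rule flag_tensor_frame)
      \<comment> \<open>The hypothesis is over the integers. The frame \<open>e\<close> gives i <= r
        <= dim V, so the natural subtractions do not truncate.\<close>
      have bound: "(CARD('a) - 1) * (dim UNIV - i + 1) \<le> CARD('a) ^ (s i - s (Suc i)) - 1" if "i \<in> {1..r}" for i
      proof -
        have "int ((CARD('a) - 1) * (dim UNIV - i + 1)) = (int CARD('a) - 1) * (int (dim UNIV) - int i + 1)"
          using that frame_length_le_dim[OF e(1)] by (simp add: of_nat_diff Suc_leI distrib_left)
        also have "\<dots> \<le> int (CARD('a) ^ (s i - s (Suc i)) - 1)"
          using assms(5)[OF that] by (simp add: q_bracket_def)
        finally show ?thesis
          by (simp only: of_nat_le_iff)
      qed
      obtain ls where ls: "\<forall>l\<in>set ls. linear_form l" "form ls (power_product ?ns e) = 1"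
        "\<And>vs. vs \<in> frames r \<Longrightarrow> flag_of vs \<noteq> flag_of e \<Longrightarrow> form ls (power_product ?ns vs) = 0"
        using ex_separating_forms[OF e(1) assms(3) s bound] by blast
      have form_flag: "form ls (?\<rho> W') = (if W' = W then 1 else 0)" if "W' \<in> complete_flags r" for W'
        using that by (rule flag_tensor_frame[where s = s]) (use ls(2,3) e in auto)
      \<comment> \<open>The functional dual to W extracts the coefficient of W, so equal images
        force equal coefficients.\<close>
      have form_lift: "form ls (free_lift ?\<rho> z) = lookup z W" if z: "z \<in> flag_space r" for z
      proof -
        have "form ls (free_lift ?\<rho> z) = (\<Sum>W'\<in>keys z. if W' = W then lookup z W' else 0)"
          unfolding form_free_lift using flags[OF z] by (intro sum.cong) (auto simp: form_flag)
        then show ?thesis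
          by (simp add: in_keys_iff)
      qed
      have "(free_lift ?\<rho> x, free_lift ?\<rho> y) \<in> tensor_eq N"
        using eq lift_words[OF y] by (intro tensor_class_eqD) (simp_all add: phi x y)
      then have "form ls (free_lift ?\<rho> x) = form ls (free_lift ?\<rho> y)"
        using form_tensor_relations[of "free_lift ?\<rho> x - free_lift ?\<rho> y" N ls] ls(1)
        by (simp add: tensor_eq_def form_diff)
      then show ?thesis
        by (simp add: form_lift x y)
    qed
    moreover have "lookup x W = 0 \<and> lookup y W = 0" if "W \<notin> complete_flags r"
      using that flags x y by (meson in_keys_iff)
    ultimately show "lookup x W = lookup y W" by metis
  qed
  ultimately show ?thesis by blast
qed

end
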